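(* Let $\mathfrak H=\mathfrak H_1\oplus\mathfrak H_2$, $\varphi\in(0,\pi/2)$, $T_{jj}\in C_{\mathfrak H_j}(\varphi)$, $j\in\{1,2\}$, and let $\mathcal H_1:=\overline{\mathrm{ran}}\,D_{T_{11}^*}$, $\mathcal H_2:=\overline{\mathrm{ran}}\,D_{T_{22}}$. Then: (i) there exist selfadjoint contractions $U_\varphi=U_\varphi^*$ in $\mathfrak H_1$ and $V_\varphi=V_\varphi^*$ in $\mathfrak H_2$ such that $$2\cot\varphi\,(\mathrm{Im}\,T_{11})=D_{T_{11}^*}U_\varphi D_{T_{11}^*}\quad\text{and}\quad 2\cot\varphi\,(\mathrm{Im}\,T_{22})=D_{T_{22}}V_\varphi D_{T_{22}};$$ (ii) for $T_{12}\in[\mathfrak H_2,\mathfrak H_1]$, $$T=\begin{pmatrix}T_{11}&T_{12}\\0&T_{22}\end{pmatrix}\in C_{\mathfrak H}(\varphi)$$ if and only if $$T_{12}=\sin\varphi\, D_{T_{11}^*}KD_{T_{22}}$$ for some $K\in[\mathcal H_2,\mathcal H_1]$ such that both operators $(I+U_\varphi)^{-1/2}K(I+V_\varphi)^{-1/2}$ and $(I-U_\varphi)^{-1/2}K(I-V_\varphi)^{-1/2}$ are contractions.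
   Context: Hilbert spaces are complex and separable; $[\mathfrak H,\mathfrak K]$ denotes bounded operators from $\mathfrak H$ to $\mathfrak K$. For a contraction $X$, $D_X:=(I-X^*X)^{1/2}$; $\mathrm{Im}\,X:=(2i)^{-1}(X-X^* )$. $C_{\mathfrak H}(\varphi)$ is the set of bounded operators $T$ on $\mathfrak H$ with $\|T\sin\varphi+i\cos\varphi\, I\|\le1$ and $\|T\sin\varphi-i\cos\varphi\, I\|\le1$. In (ii), $U_\varphi$ and $V_\varphi$ are regarded as operators in $\mathcal H_1$ and $\mathcal H_2$ respectively (they are normalized to vanish on $\ker D_{T_{11}^*}$ and $\ker D_{T_{22}}$, which makes them unique), and the statement that $(I\pm U_\varphi)^{-1/2}K(I\pm V_\varphi)^{-1/2}$ is a contraction means that $K=(I\pm U_\varphi)^{1/2}K_\pm(I\pm V_\varphi)^{1/2}$ for some contraction $K_\pm\in[\mathcal H_2,\mathcal H_1]$. *)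

theory Defs
  imports "HOL-Analysis.Analysis"
begin

section \<open>Complex Hilbert spaces\<close>

text \<open>
  A complex Hilbert space is described on top of its underlying real Hilbert space: the complex
  scalar multiplication extends the real one, and the complex inner product (linear in the first
  argument) has the real inner product as its real part. Positivity, definiteness,
  \<open>norm x = sqrt (Re (cinner x x))\<close> and completeness are inherited from \<^class>\<open>real_inner\<close> and
  \<^class>\<open>complete_space\<close>.
\<close>

class chilbert_space = real_inner + complete_space +
  fixes scaleC :: "complex \<Rightarrow> 'a \<Rightarrow> 'a"  (infixr "*\<^sub>C" 75)
    and cinner :: "'a \<Rightarrow> 'a \<Rightarrow> complex"
  assumes scaleC_add_right: "c *\<^sub>C (x + y) = c *\<^sub>C x + c *\<^sub>C y"
    and scaleC_add_left: "(c + d) *\<^sub>C x = c *\<^sub>C x + d *\<^sub>C x"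
    and scaleC_scaleC: "c *\<^sub>C d *\<^sub>C x = (c * d) *\<^sub>C x"
    and scaleC_of_real: "complex_of_real r *\<^sub>C x = r *\<^sub>R x"
    and cinner_add_left: "cinner (x + y) z = cinner x z + cinner y z"
    and cinner_scaleC_left: "cinner (c *\<^sub>C x) y = c * cinner x y"
    and cinner_commute: "cinner x y = cnj (cinner y x)"
    and Re_cinner: "Re (cinner x y) = inner x y"

text \<open>
  The orthogonal direct sum. The library norm on the product type is already the Hilbert space
  norm \<open>sqrt ((norm x)\<^sup>2 + (norm y)\<^sup>2)\<close>.
\<close>

instantiation prod :: (chilbert_space, chilbert_space) chilbert_space
begin

definition scaleC_prod :: "complex \<Rightarrow> 'a \<times> 'b \<Rightarrow> 'a \<times> 'b"
  where "scaleC_prod c p = (c *\<^sub>C fst p, c *\<^sub>C snd p)"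

definition cinner_prod :: "'a \<times> 'b \<Rightarrow> 'a \<times> 'b \<Rightarrow> complex"
  where "cinner_prod p q = cinner (fst p) (fst q) + cinner (snd p) (snd q)"

instance
proof
  fix p q r :: "'a \<times> 'b" and c d :: complex and t :: real
  show "c *\<^sub>C (p + q) = c *\<^sub>C p + c *\<^sub>C q"
    by (simp add: scaleC_prod_def scaleC_add_right)
  show "(c + d) *\<^sub>C p = c *\<^sub>C p + d *\<^sub>C p"
    by (simp add: scaleC_prod_def scaleC_add_left)
  show "c *\<^sub>C d *\<^sub>C p = (c * d) *\<^sub>C p"
    by (simp add: scaleC_prod_def scaleC_scaleC)
  show "complex_of_real t *\<^sub>C p = t *\<^sub>R p"
    by (simp add: scaleC_prod_def scaleC_of_real scaleR_prod_def)
  show "cinner (p + q) r = cinner p r + cinner q r"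
    by (simp add: cinner_prod_def cinner_add_left)
  show "cinner (c *\<^sub>C p) q = c * cinner p q"
    by (simp add: cinner_prod_def scaleC_prod_def cinner_scaleC_left distrib_left)
  show "cinner p q = cnj (cinner q p)"
    unfolding cinner_prod_def complex_cnj_add by (metis cinner_commute)
  show "Re (cinner p q) = inner p q"
    by (simp add: cinner_prod_def Re_cinner inner_prod_def)
qed

end

section \<open>Bounded operators\<close>

text \<open>
  \<open>bops S R\<close> is the space \<open>[S, R]\<close> of bounded complex-linear operators from the closed subspace
  \<open>S\<close> to the closed subspace \<open>R\<close>; the values of the underlying HOL function outside \<open>S\<close> are
  irrelevant.
\<close>

definition bops :: "'a::chilbert_space set \<Rightarrow> 'b::chilbert_space set \<Rightarrow> ('a \<Rightarrow> 'b) set"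
  where "bops S R = {F.
      (\<forall>x\<in>S. F x \<in> R) \<and>
      (\<forall>x\<in>S. \<forall>y\<in>S. F (x + y) = F x + F y) \<and>
      (\<forall>c. \<forall>x\<in>S. F (c *\<^sub>C x) = c *\<^sub>C F x) \<and>
      (\<exists>M. \<forall>x\<in>S. norm (F x) \<le> M * norm x)}"

definition contractions ::
    "'a::chilbert_space set \<Rightarrow> 'b::chilbert_space set \<Rightarrow> ('a \<Rightarrow> 'b) set"
  where "contractions S R = {F \<in> bops S R. \<forall>x\<in>S. norm (F x) \<le> norm x}"

definition adj :: "('a::chilbert_space \<Rightarrow> 'b::chilbert_space) \<Rightarrow> 'b \<Rightarrow> 'a"
  where "adj X = (THE Y. Y \<in> bops UNIV UNIV \<and> (\<forall>x y. cinner (X x) y = cinner x (Y y)))"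

definition op_Im :: "('a::chilbert_space \<Rightarrow> 'a) \<Rightarrow> 'a \<Rightarrow> 'a"
  where "op_Im X = (\<lambda>x. (1 / (2 * \<i>)) *\<^sub>C (X x - adj X x))"

definition positive_on :: "'a::chilbert_space set \<Rightarrow> ('a \<Rightarrow> 'a) \<Rightarrow> bool"
  where "positive_on S A \<longleftrightarrow> A \<in> bops S S \<and> (\<forall>x\<in>S. cinner (A x) x \<in> \<real>\<^sub>\<ge>\<^sub>0)"

text \<open>
  The positive square root of a positive operator \<open>A\<close> in the Hilbert space \<open>S\<close> (a closed subspace
  of the ambient type). The value \<open>0\<close> outside \<open>S\<close> only serves to make it unique as a HOL function.
\<close>

definition sqrt_on :: "'a::chilbert_space set \<Rightarrow> ('a \<Rightarrow> 'a) \<Rightarrow> 'a \<Rightarrow> 'a"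
  where "sqrt_on S A = (THE B. positive_on S B \<and> (\<forall>x\<in>S. B (B x) = A x) \<and> (\<forall>x. x \<notin> S \<longrightarrow> B x = 0))"

text \<open>The defect operator \<open>D\<^sub>X = (I - X\<^sup>* X)\<^sup>1\<^sup>/\<^sup>2\<close> of a contraction, and the closure of its range.\<close>

definition defect :: "('a::chilbert_space \<Rightarrow> 'b::chilbert_space) \<Rightarrow> 'a \<Rightarrow> 'a"
  where "defect X = sqrt_on UNIV (\<lambda>x. x - adj X (X x))"

definition defect_space :: "('a::chilbert_space \<Rightarrow> 'b::chilbert_space) \<Rightarrow> 'a set"
  where "defect_space X = closure (range (defect X))"

definition selfadjoint :: "('a::chilbert_space \<Rightarrow> 'a) \<Rightarrow> bool"
  where "selfadjoint A \<longleftrightarrow> A \<in> bops UNIV UNIV \<and> adj A = A"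

section \<open>The class \<open>C(\<phi>)\<close> and block operators\<close>

definition C_class :: "real \<Rightarrow> ('a::chilbert_space \<Rightarrow> 'a) set"
  where "C_class \<phi> = {T \<in> bops UNIV UNIV.
      onorm (\<lambda>x. sin \<phi> *\<^sub>R T x + (\<i> * cos \<phi>) *\<^sub>C x) \<le> 1 \<and>
      onorm (\<lambda>x. sin \<phi> *\<^sub>R T x - (\<i> * cos \<phi>) *\<^sub>C x) \<le> 1}"

definition upper_block ::
    "('a::chilbert_space \<Rightarrow> 'a) \<Rightarrow> ('b::chilbert_space \<Rightarrow> 'a) \<Rightarrow> ('b \<Rightarrow> 'b) \<Rightarrow> 'a \<times> 'b \<Rightarrow> 'a \<times> 'b"
  where "upper_block T11 T12 T22 = (\<lambda>(x, y). (T11 x + T12 y, T22 y))"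

text \<open>
  \<open>W\<close> is the selfadjoint contraction with \<open>2 cot \<phi> Im T = D W D\<close>, where \<open>D\<close> is a defect operator
  of \<open>T\<close> or of its adjoint, normalized to vanish on \<open>ker D\<close>.
\<close>

definition normalized_angle_op ::
    "real \<Rightarrow> ('a::chilbert_space \<Rightarrow> 'a) \<Rightarrow> ('a \<Rightarrow> 'a) \<Rightarrow> ('a \<Rightarrow> 'a) \<Rightarrow> bool"
  where "normalized_angle_op \<phi> T D W \<longleftrightarrow>
      selfadjoint W \<and> W \<in> contractions UNIV UNIV \<and>
      (\<lambda>x. (2 * cot \<phi>) *\<^sub>R op_Im T x) = D \<circ> W \<circ> D \<and>
      (\<forall>x. D x = 0 \<longrightarrow> W x = 0)"

text \<open>
  For operators \<open>P\<close> in \<open>H1\<close> and \<open>Q\<close> in \<open>H2\<close>, positive but not necessarily invertible, this says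
  that \<open>P\<^sup>-\<^sup>1\<^sup>/\<^sup>2 K Q\<^sup>-\<^sup>1\<^sup>/\<^sup>2\<close> is a contraction, in the sense that \<open>K\<close> factors through a contraction.
\<close>

definition sandwich_contraction ::
    "'a::chilbert_space set \<Rightarrow> 'b::chilbert_space set \<Rightarrow> ('a \<Rightarrow> 'a) \<Rightarrow> ('b \<Rightarrow> 'a) \<Rightarrow> ('b \<Rightarrow> 'b) \<Rightarrow> bool"
  where "sandwich_contraction H1 H2 P K Q \<longleftrightarrow>
      (\<exists>K'\<in>contractions H2 H1. \<forall>y\<in>H2. K y = sqrt_on H1 P (K' (sqrt_on H2 Q y)))"

end

theory Submission
  imports Defs
begin

text \<open>
  Expanding \<open>\<parallel>x\<parallel>\<^sup>2 - \<parallel>(T sin \<phi> \<plusminus> i cos \<phi>) x\<parallel>\<^sup>2\<close> turns membership in \<open>C(\<phi>)\<close> into the quadratic form bound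
  \<open>2 cot \<phi> |(Im T x, x)| \<le> \<parallel>D\<^sub>T x\<parallel>\<^sup>2\<close> (and likewise for the adjoint), so the form of \<open>2 cot \<phi> Im T\<close>
  factors through the defect operator; this gives the angle operators. For the triangular \<open>T\<close>, both
  operators \<open>T sin \<phi> \<plusminus> i cos \<phi>\<close> are again triangular, and a triangular matrix with entries \<open>A, C, B\<close> is a
  contraction iff \<open>|(C y, x)|\<^sup>2 \<le> (\<parallel>x\<parallel>\<^sup>2 - \<parallel>A\<^sup>* x\<parallel>\<^sup>2) (\<parallel>y\<parallel>\<^sup>2 - \<parallel>B y\<parallel>\<^sup>2)\<close>. In terms of the angle
  operators the right-hand side is the product of the forms of \<open>I \<minusplus> U\<close> and \<open>I \<minusplus> V\<close> at the vectors
  \<open>D x\<close> and \<open>D y\<close>, which by the same factorization of forms describes \<open>K\<close>.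

  All estimates use the real inner product: by phase invariance nothing is lost.
\<close>

section \<open>Complex subspaces and bounded operators\<close>

text \<open>Makes the comparison test for series applicable; the square root iteration converges by
  it.\<close>

instance chilbert_space \<subseteq> banach ..

lemma scaleC_zero_right [simp]: "c *\<^sub>C (0::'a::chilbert_space) = 0"
  using scaleC_add_right[of c 0 "0::'a"] by simp

lemma scaleC_ii_ii [simp]: "\<i> *\<^sub>C \<i> *\<^sub>C (x::'a::chilbert_space) = - x"
  using scaleC_scaleC[of \<i> \<i> x] scaleC_of_real[of "-1" x] by simp

lemma scaleC_minus_left: "(- c) *\<^sub>C (x::'a::chilbert_space) = - (c *\<^sub>C x)"
  using scaleC_scaleC[of "-1" c x] scaleC_of_real[of "-1" "c *\<^sub>C x"] by simp

lemma inner_scaleC_left: "inner (c *\<^sub>C (x::'a::chilbert_space)) y = inner x (cnj c *\<^sub>C y)"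
proof -
  have "cinner (c *\<^sub>C x) y = c * cnj (cinner y x)"
    by (metis cinner_scaleC_left cinner_commute)
  moreover have "cinner x (cnj c *\<^sub>C y) = c * cnj (cinner y x)"
    by (metis cinner_scaleC_left cinner_commute complex_cnj_mult complex_cnj_cnj)
  ultimately show ?thesis by (metis Re_cinner)
qed

lemma inner_ii_left: "inner (\<i> *\<^sub>C (x::'a::chilbert_space)) y = - inner x (\<i> *\<^sub>C y)"
  by (simp add: inner_scaleC_left scaleC_minus_left)

lemma inner_ii_ii [simp]: "inner (\<i> *\<^sub>C (x::'a::chilbert_space)) (\<i> *\<^sub>C y) = inner x y"
  by (simp add: inner_ii_left)

lemma scaleC_scaleR: "c *\<^sub>C r *\<^sub>R (x::'a::chilbert_space) = r *\<^sub>R c *\<^sub>C x"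
  by (metis scaleC_scaleC scaleC_of_real mult.commute)

lemma norm_scaleC: "norm (c *\<^sub>C (x::'a::chilbert_space)) = cmod c * norm x"
proof -
  have "inner (c *\<^sub>C x) (c *\<^sub>C x) = (cmod c)\<^sup>2 * inner x x"
    by (simp add: inner_scaleC_left scaleC_scaleC mult.commute[of "cnj c"] complex_norm_square[symmetric]
        scaleC_of_real flip: of_real_power)
  then show ?thesis
    by (simp add: norm_eq_sqrt_inner real_sqrt_mult)
qed

lemma bounded_linear_scaleC: "bounded_linear (\<lambda>x::'a::chilbert_space. c *\<^sub>C x)"
  by (rule bounded_linear_intro[of _ "cmod c"]) (auto simp: scaleC_add_right scaleC_scaleR norm_scaleC)

lemma Im_cinner: "Im (cinner x y) = - inner (\<i> *\<^sub>C x) y"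
  using Re_cinner[of "\<i> *\<^sub>C x" y] by (simp add: cinner_scaleC_left)

text \<open>The imaginary part of the complex inner product is a real inner product with
  \<open>\<i> *\<^sub>C x\<close>, so two real identities carry the whole complex one. This allows
  the remaining work to stay with \<open>inner\<close>.\<close>

lemma cinner_eqI:
  assumes "inner x y = inner u v" "inner (\<i> *\<^sub>C x) y = inner (\<i> *\<^sub>C u) v"
  shows "cinner x y = cinner u v"
  using assms by (simp add: complex_eq_iff Re_cinner Im_cinner)

section \<open>Complex subspaces and their closures\<close>

text \<open>Closedness is not part of the notion, so that ranges of operators qualify; it is assumed
  separately where limits are taken.\<close>

definition csubspace :: "'a::chilbert_space set \<Rightarrow> bool"
  where "csubspace S \<longleftrightarrow> 0 \<in> S \<and> (\<forall>x\<in>S. \<forall>y\<in>S. x + y \<in> S) \<and> (\<forall>c. \<forall>x\<in>S. c *\<^sub>C x \<in> S)"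

lemma csubspace_UNIV [simp]: "csubspace UNIV"
  by (simp add: csubspace_def)

lemma csubspace_0: "csubspace S \<Longrightarrow> 0 \<in> S"
  and csubspace_add: "csubspace S \<Longrightarrow> x \<in> S \<Longrightarrow> y \<in> S \<Longrightarrow> x + y \<in> S"
  and csubspace_scaleC: "csubspace S \<Longrightarrow> x \<in> S \<Longrightarrow> c *\<^sub>C x \<in> S"
  by (auto simp: csubspace_def)

lemma csubspace_scaleR: "csubspace S \<Longrightarrow> x \<in> S \<Longrightarrow> r *\<^sub>R x \<in> S"
  by (metis csubspace_scaleC scaleC_of_real)

lemma csubspace_diff: "csubspace S \<Longrightarrow> x \<in> S \<Longrightarrow> y \<in> S \<Longrightarrow> x - y \<in> S"
  using csubspace_add[of S x "- y"] csubspace_scaleR[of S y "-1"] by simp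

lemmas csubspace_intros =
  csubspace_0 csubspace_add csubspace_scaleC csubspace_scaleR csubspace_diff

lemma csubspace_closure:
  assumes "csubspace S"
  shows "csubspace (closure S)"
  unfolding csubspace_def
proof (intro conjI ballI allI)
  show "0 \<in> closure S"
    using assms closure_subset csubspace_0 by blast
next
  fix x y assume "x \<in> closure S" "y \<in> closure S"
  then obtain f g where "\<forall>n. f n \<in> S" "f \<longlonglongrightarrow> x" "\<forall>n. g n \<in> S" "g \<longlonglongrightarrow> y"
    unfolding closure_sequential by blast
  then show "x + y \<in> closure S"
    unfolding closure_sequential
    by (intro exI[of _ "\<lambda>n. f n + g n"]) (auto intro: tendsto_add csubspace_add assms)
next
  fix c x assume "x \<in> closure S"
  then obtain f where "\<forall>n. f n \<in> S" "f \<longlonglongrightarrow> x"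
    unfolding closure_sequential by blast
  then show "c *\<^sub>C x \<in> closure S"
    unfolding closure_sequential
    by (intro exI[of _ "\<lambda>n. c *\<^sub>C f n"])
      (auto intro: csubspace_scaleC assms bounded_linear.tendsto[OF bounded_linear_scaleC])
qed

section \<open>Calculus of bounded operators between subspaces\<close>

lemma bopsI:
  assumes "\<And>x. x \<in> S \<Longrightarrow> F x \<in> R"
    and "\<And>x y. x \<in> S \<Longrightarrow> y \<in> S \<Longrightarrow> F (x + y) = F x + F y"
    and "\<And>c x. x \<in> S \<Longrightarrow> F (c *\<^sub>C x) = c *\<^sub>C F x"
    and "\<And>x. x \<in> S \<Longrightarrow> norm (F x) \<le> M * norm x"
  shows "F \<in> bops S R"
  unfolding bops_def using assms by (auto intro!: exI[of _ M])

lemma bops_in: "F \<in> bops S R \<Longrightarrow> x \<in> S \<Longrightarrow> F x \<in> R"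
  and bops_add: "F \<in> bops S R \<Longrightarrow> x \<in> S \<Longrightarrow> y \<in> S \<Longrightarrow> F (x + y) = F x + F y"
  and bops_scaleC: "F \<in> bops S R \<Longrightarrow> x \<in> S \<Longrightarrow> F (c *\<^sub>C x) = c *\<^sub>C F x"
  by (auto simp: bops_def)

lemma bops_scaleR: "F \<in> bops S R \<Longrightarrow> x \<in> S \<Longrightarrow> F (r *\<^sub>R x) = r *\<^sub>R F x"
  by (metis bops_scaleC scaleC_of_real)

lemma bops_diff: "F \<in> bops S R \<Longrightarrow> csubspace S \<Longrightarrow> x \<in> S \<Longrightarrow> y \<in> S \<Longrightarrow> F (x - y) = F x - F y"
  using bops_add[of F S R x "- y"] bops_scaleR[of F S R y "-1"] csubspace_scaleR[of S y "-1"] by simp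

lemma bops_0: "F \<in> bops S R \<Longrightarrow> csubspace S \<Longrightarrow> F 0 = 0"
  using bops_scaleR[of F S R 0 0] csubspace_0[of S] by simp

lemmas bops_lin = bops_add bops_diff bops_scaleR bops_scaleC bops_0

lemma bops_bound:
  assumes "F \<in> bops S R"
  obtains M where "M \<ge> 0" "\<And>x. x \<in> S \<Longrightarrow> norm (F x) \<le> M * norm x"
proof -
  obtain M where M: "\<And>x. x \<in> S \<Longrightarrow> norm (F x) \<le> M * norm x"
    using assms unfolding bops_def by blast
  show ?thesis
  proof
    \<comment> \<open>The definition of \<open>bops\<close> leaves the sign of the bound free, and
      on the zero space it may be negative.\<close>
    show "\<bar>M\<bar> \<ge> 0" by simp
    show "norm (F x) \<le> \<bar>M\<bar> * norm x" if "x \<in> S" for x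
      using M[OF that] mult_right_mono[OF abs_ge_self[of M] norm_ge_zero[of x]] by linarith
  qed
qed

lemma bops_mono: "F \<in> bops S R \<Longrightarrow> S' \<subseteq> S \<Longrightarrow> R \<subseteq> R' \<Longrightarrow> F \<in> bops S' R'"
  unfolding bops_def by blast

lemma bops_bounded_linear:
  assumes "F \<in> bops UNIV R"
  shows "bounded_linear F"
proof -
  obtain M where M: "\<And>x. norm (F x) \<le> M * norm x"
    using bops_bound[OF assms] by (metis UNIV_I)
  show ?thesis
    by (rule bounded_linear_intro[of F M])
      (use M in \<open>auto simp: bops_add[OF assms] bops_scaleR[OF assms] mult.commute\<close>)
qed

lemma bops_id: "S \<subseteq> R \<Longrightarrow> (\<lambda>x. x) \<in> bops S R"
  by (rule bopsI[where M = 1]) auto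

lemma bops_plus:
  assumes "csubspace R" "F \<in> bops S R" "G \<in> bops S R"
  shows "(\<lambda>x. F x + G x) \<in> bops S R"
proof -
  obtain M N where M: "M \<ge> 0" "\<And>x. x \<in> S \<Longrightarrow> norm (F x) \<le> M * norm x"
    and N: "N \<ge> 0" "\<And>x. x \<in> S \<Longrightarrow> norm (G x) \<le> N * norm x"
    using assms by (metis bops_bound)
  show ?thesis
  proof (rule bopsI)
    show "norm (F x + G x) \<le> (M + N) * norm x" if "x \<in> S" for x
      using M(2)[OF that] N(2)[OF that] norm_triangle_ineq[of "F x" "G x"] by (simp add: algebra_simps)
  qed (use assms in \<open>auto simp: bops_add bops_scaleC bops_in scaleC_add_right csubspace_add\<close>)
qed

lemma bops_scaleC_left:
  assumes "csubspace R" "F \<in> bops S R"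
  shows "(\<lambda>x. c *\<^sub>C F x) \<in> bops S R"
proof -
  obtain M where M: "M \<ge> 0" "\<And>x. x \<in> S \<Longrightarrow> norm (F x) \<le> M * norm x"
    using assms by (metis bops_bound)
  show ?thesis
  proof (rule bopsI)
    show "norm (c *\<^sub>C F x) \<le> (cmod c * M) * norm x" if "x \<in> S" for x
      using mult_left_mono[OF M(2)[OF that], of "cmod c"] by (simp add: norm_scaleC)
  qed (use assms in \<open>auto simp: bops_add bops_scaleC bops_in scaleC_add_right scaleC_scaleC csubspace_scaleC mult.commute\<close>)
qed

lemma bops_scaleR_left: "csubspace R \<Longrightarrow> F \<in> bops S R \<Longrightarrow> (\<lambda>x. r *\<^sub>R F x) \<in> bops S R"
  using bops_scaleC_left[of R F S "complex_of_real r"] by (simp add: scaleC_of_real)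

lemma bops_minus:
  assumes "csubspace R" "F \<in> bops S R" "G \<in> bops S R"
  shows "(\<lambda>x. F x - G x) \<in> bops S R"
  using bops_plus[OF assms(1,2) bops_scaleR_left[OF assms(1,3), of "-1"]] by simp

lemma bops_comp:
  assumes "F \<in> bops S R" "G \<in> bops R Q"
  shows "(\<lambda>x. G (F x)) \<in> bops S Q"
proof -
  obtain M N where M: "M \<ge> 0" "\<And>x. x \<in> S \<Longrightarrow> norm (F x) \<le> M * norm x"
    and N: "N \<ge> 0" "\<And>x. x \<in> R \<Longrightarrow> norm (G x) \<le> N * norm x"
    using assms by (metis bops_bound)
  show ?thesis
  proof (rule bopsI)
    show "norm (G (F x)) \<le> (N * M) * norm x" if "x \<in> S" for x
      using order_trans[OF N(2)[OF bops_in[OF assms(1) that]] mult_left_mono[OF M(2)[OF that] N(1)]]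
      by simp
  qed (use assms in \<open>auto simp: bops_add bops_scaleC bops_in\<close>)
qed

lemma csubspace_image: "csubspace S \<Longrightarrow> F \<in> bops S R \<Longrightarrow> csubspace (F ` S)"
  unfolding csubspace_def[of "F ` S"]
  by (auto simp: image_iff) (metis bops_0 csubspace_0, metis bops_add csubspace_add,
      metis bops_scaleC csubspace_scaleC)

section \<open>Density arguments and the discriminant criterion\<close>

lemma inner_closure_le:
  assumes "u \<in> closure (S::'a::real_inner set)" "\<And>z. z \<in> S \<Longrightarrow> inner v z \<le> M * norm z"
  shows "inner v u \<le> M * norm u"
proof -
  have "closed {z. inner v z \<le> M * norm z}"
    by (intro closed_Collect_le continuous_intros)
  then show ?thesis
    using closure_minimal[of S "{z. inner v z \<le> M * norm z}"] assms by blast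
qed

lemma inner_closure_eq:
  assumes "u \<in> closure (S::'a::real_inner set)" "\<And>z. z \<in> S \<Longrightarrow> inner v z = inner w z"
  shows "inner v u = inner w u"
proof -
  have "closed {z. inner v z = inner w z}"
    by (intro closed_Collect_eq continuous_intros)
  then show ?thesis
    using closure_minimal[of S "{z. inner v z = inner w z}"] assms by blast
qed

text \<open>The difference \<open>u - v\<close> lies in the closure and is orthogonal to
  \<open>S\<close>, hence orthogonal to itself. This gives uniqueness of representing
  vectors.\<close>

lemma closure_inner_eqI:
  assumes "csubspace S" "u \<in> closure S" "v \<in> closure S" "\<And>z. z \<in> S \<Longrightarrow> inner u z = inner v z"
  shows "u = v"
proof -
  have "u - v \<in> closure S"
    using assms csubspace_closure csubspace_diff by blast
  then have "inner u (u - v) = inner v (u - v)"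
    using assms(4) by (rule inner_closure_eq)
  then show ?thesis
    by (metis inner_diff_left inner_eq_zero_iff right_minus_eq)
qed

text \<open>Discriminant criterion: evaluate the quadratic at its minimizer \<open>- c / A\<close>.
  The case \<open>A = 0\<close> is separate, since a nonnegative affine function must be
  constant.\<close>

lemma quad_nonneg:
  assumes "\<And>t::real. 0 \<le> A * t\<^sup>2 + 2 * c * t + B" "A \<ge> 0"
  shows "c\<^sup>2 \<le> A * B"
proof (cases "A = 0")
  case True
  have "c = 0"
  proof (rule ccontr)
    assume "c \<noteq> 0"
    \<comment> \<open>At this point the affine function takes the value -1.\<close>
    then show False using assms(1)[of "- (B + 1) / (2 * c)"] True by simp
  qed
  then show ?thesis using True by simp
next
  case False
  then have "A > 0" using assms by simp
  have "0 \<le> A * (A * (- c / A)\<^sup>2 + 2 * c * (- c / A) + B)"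
    using assms(1)[of "- c / A"] \<open>A \<ge> 0\<close> by (rule mult_nonneg_nonneg[rotated])
  also have "\<dots> = A * B - c\<^sup>2"
    using \<open>A > 0\<close> by (simp add: field_simps power2_eq_square)
  finally show ?thesis by simp
qed

section \<open>Riesz representation and factorization of forms\<close>

text \<open>Minimizing \<open>\<parallel>Q y\<parallel>\<^sup>2 - 2 f y\<close> represents \<open>f\<close> through \<open>Q\<close> even when \<open>Q\<close> is not injective and
  its range is not closed.\<close>

lemma riesz_pullback:
  assumes Y: "csubspace Y" and Q: "Q \<in> bops Y R"
    and add: "\<And>x y. x \<in> Y \<Longrightarrow> y \<in> Y \<Longrightarrow> f (x + y) = f x + f y"
    and scale: "\<And>r x. x \<in> Y \<Longrightarrow> f (r *\<^sub>R x) = r * f x"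
    and bound: "\<And>y. y \<in> Y \<Longrightarrow> \<bar>f y\<bar> \<le> M * norm (Q y)"
    and M: "M \<ge> (0::real)"
  obtains u where "u \<in> closure (Q ` Y)" "norm u \<le> M" "\<And>y. y \<in> Y \<Longrightarrow> f y = inner u (Q y)"
proof -
  define J where "J y = (norm (Q y))\<^sup>2 - 2 * f y" for y
  have J_lower: "- M\<^sup>2 \<le> J y" if "y \<in> Y" for y
  proof -
    have "0 \<le> (norm (Q y) - M)\<^sup>2" by simp
    then show ?thesis using bound[OF that] by (simp add: J_def power2_diff algebra_simps)
  qed
  define m where "m = Inf (J ` Y)"
  have bdd: "bdd_below (J ` Y)" using J_lower by (rule bdd_belowI2)
  have m_le: "m \<le> J y" if "y \<in> Y" for y
    unfolding m_def using bdd that by (rule cINF_lower)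
  have "\<exists>y\<in>Y. J y < m + inverse (real (Suc n))" for n
    unfolding m_def using Y bdd
    by (subst cINF_less_iff[symmetric]) (auto dest: csubspace_0)
  then obtain s where s: "\<And>n. s n \<in> Y" "\<And>n. J (s n) < m + inverse (real (Suc n))"
    by metis
  \<comment> \<open>The midpoint of \<open>x\<close> and \<open>y\<close> cannot beat the infimum,
    so the parallelogram law controls the distance of the images. Minimizing sequences therefore
    have Cauchy images under \<open>Q\<close>, although they need not converge themselves.\<close>
  have parallelogram: "(norm (Q x - Q y))\<^sup>2 \<le> 2 * (J x - m) + 2 * (J y - m)"
    if "x \<in> Y" "y \<in> Y" for x y
  proof -
    let ?z = "(1/2) *\<^sub>R (x + y)"
    have "m \<le> J ?z" using that Y by (intro m_le) (auto intro: csubspace_intros)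
    moreover have "Q ?z = (1/2) *\<^sub>R (Q x + Q y)" "f ?z = (f x + f y) / 2"
      using that Y by (simp_all only: bops_scaleR[OF Q] bops_add[OF Q] csubspace_add scale add)
    then have "4 * J ?z = (norm (Q x + Q y))\<^sup>2 - 4 * (f x + f y)"
      by (simp add: J_def power2_eq_square)
    moreover have "(norm (Q x + Q y))\<^sup>2 + (norm (Q x - Q y))\<^sup>2 = 2 * (norm (Q x))\<^sup>2 + 2 * (norm (Q y))\<^sup>2"
      by (simp add: power2_norm_eq_inner inner_simps inner_commute)
    ultimately show ?thesis by (simp add: J_def)
  qed
  have "Cauchy (\<lambda>n. Q (s n))"
  proof (rule metric_CauchyI)
    fix e :: real assume "e > 0"
    then obtain N where N: "inverse (real (Suc N)) < e\<^sup>2 / 4"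
      using reals_Archimedean[of "e\<^sup>2 / 4"] by auto
    have small: "J (s n) - m < e\<^sup>2 / 4" if "n \<ge> N" for n
    proof -
      have "inverse (real (Suc n)) \<le> inverse (real (Suc N))" using that by simp
      then show ?thesis using s(2)[of n] N by linarith
    qed
    have "dist (Q (s k)) (Q (s n)) < e" if "k \<ge> N" "n \<ge> N" for k n
    proof -
      have "(norm (Q (s k) - Q (s n)))\<^sup>2 < e\<^sup>2"
        using parallelogram[OF s(1)[of k] s(1)[of n]] small[OF that(1)] small[OF that(2)] by simp
      then show ?thesis
        using \<open>e > 0\<close> by (simp add: dist_norm power_less_imp_less_base)
    qed
    then show "\<exists>N. \<forall>k\<ge>N. \<forall>n\<ge>N. dist (Q (s k)) (Q (s n)) < e" by blast
  qed
  then obtain u where u: "(\<lambda>n. Q (s n)) \<longlonglongrightarrow> u"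
    using convergent_eq_Cauchy by blast
  have u_closure: "u \<in> closure (Q ` Y)"
    unfolding closure_sequential using u s(1) by (intro exI[of _ "\<lambda>n. Q (s n)"]) auto
  have rep: "f y = inner u (Q y)" if y: "y \<in> Y" for y
  proof -
    \<comment> \<open>\<open>2 * c n\<close> is the derivative of \<open>J\<close> at
      \<open>s n\<close> in the direction \<open>y\<close>. Since \<open>s n\<close> is an
      almost-minimizer, the discriminant criterion forces it to tend to 0.\<close>
    define c where "c n = inner (Q (s n)) (Q y) - f y" for n
    have c: "(c n)\<^sup>2 \<le> (norm (Q y))\<^sup>2 * inverse (real (Suc n))" for n
    proof (rule quad_nonneg)
      fix t :: real
      have "m \<le> J (s n + t *\<^sub>R y)"
        using y s(1) Y by (intro m_le) (auto intro: csubspace_intros)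
      also have "\<dots> = J (s n) + 2 * c n * t + (norm (Q y))\<^sup>2 * t\<^sup>2"
        using y s(1)[of n] Y
        by (simp add: J_def c_def bops_lin[OF Q] csubspace_intros scale add
            power2_norm_eq_inner inner_simps inner_commute power2_eq_square[of t] algebra_simps)
      finally show "0 \<le> (norm (Q y))\<^sup>2 * t\<^sup>2 + 2 * c n * t + inverse (real (Suc n))"
        using s(2)[of n] by simp
    qed simp
    have "(\<lambda>n. (norm (Q y))\<^sup>2 * inverse (real (Suc n))) \<longlonglongrightarrow> (norm (Q y))\<^sup>2 * 0"
      by (intro tendsto_intros LIMSEQ_inverse_real_of_nat)
    moreover have "(\<lambda>n. (c n)\<^sup>2) \<longlonglongrightarrow> (inner u (Q y) - f y)\<^sup>2"
      unfolding c_def by (intro tendsto_intros u)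
    ultimately have "(inner u (Q y) - f y)\<^sup>2 \<le> 0"
      using c by (metis (no_types, lifting) LIMSEQ_le mult_zero_right)
    then show ?thesis by simp
  qed
  \<comment> \<open>The bound on \<open>f\<close>, rewritten as a bound on \<open>inner u\<close>
    over the image of \<open>Q\<close>, passes to the closure and may be evaluated at
    \<open>u\<close> itself.\<close>
  have "inner u u \<le> M * norm u"
    using u_closure by (rule inner_closure_le) (use rep bound in force)
  then have "norm u \<le> M"
    using M by (cases "u = 0") (auto simp: power2_norm_eq_inner[symmetric] power2_eq_square)
  with u_closure rep show ?thesis using that by blast
qed

text \<open>For fixed \<open>x\<close> the functional \<open>inner x (T y)\<close> is represented
  through \<open>Q\<close> by \<open>riesz_pullback\<close>. The representing vector is unique in
  the closure of the image of \<open>Q\<close>, and uniqueness makes it depend linearly on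
  \<open>x\<close>.\<close>

lemma form_representation:
  assumes X: "csubspace X" and Y: "csubspace Y" and Q: "Q \<in> bops Y R" and T: "T \<in> bops Y R'"
    and bound: "\<And>x y. x \<in> X \<Longrightarrow> y \<in> Y \<Longrightarrow> \<bar>inner x (T y)\<bar> \<le> n x * norm (Q y)"
    and n: "\<And>x. x \<in> X \<Longrightarrow> 0 \<le> n x" "\<And>x. x \<in> X \<Longrightarrow> n x \<le> C * norm x"
  obtains k where "k \<in> bops X (closure (Q ` Y))" "\<And>x. x \<in> X \<Longrightarrow> norm (k x) \<le> n x"
    "\<And>x y. x \<in> X \<Longrightarrow> y \<in> Y \<Longrightarrow> inner x (T y) = inner (k x) (Q y)"
proof -
  have "\<exists>u. u \<in> closure (Q ` Y) \<and> norm u \<le> n x \<and> (\<forall>y\<in>Y. inner x (T y) = inner u (Q y))"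
    if "x \<in> X" for x
    by (rule riesz_pullback[OF Y Q, of "\<lambda>y. inner x (T y)" "n x"])
      (use that bound n in \<open>auto simp: bops_add[OF T] bops_scaleR[OF T] inner_simps\<close>)
  then obtain k where k: "\<And>x. x \<in> X \<Longrightarrow> k x \<in> closure (Q ` Y)" "\<And>x. x \<in> X \<Longrightarrow> norm (k x) \<le> n x"
    "\<And>x y. x \<in> X \<Longrightarrow> y \<in> Y \<Longrightarrow> inner x (T y) = inner (k x) (Q y)"
    by metis
  note QY = csubspace_image[OF Y Q]
  note cl = csubspace_closure[OF QY]
  have "k \<in> bops X (closure (Q ` Y))"
  proof (rule bopsI)
    fix x y assume xy: "x \<in> X" "y \<in> X"
    show "k (x + y) = k x + k y"
    proof (rule closure_inner_eqI[OF QY])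
      fix z assume "z \<in> Q ` Y"
      then obtain w where w: "w \<in> Y" "z = Q w" by blast
      then show "inner (k (x + y)) z = inner (k x + k y) z"
        using xy X by (simp add: inner_add_left k(3)[symmetric] csubspace_add)
    qed (use k(1) xy X cl in \<open>auto intro: csubspace_intros\<close>)
  next
    fix c x assume x: "x \<in> X"
    show "k (c *\<^sub>C x) = c *\<^sub>C k x"
    proof (rule closure_inner_eqI[OF QY])
      fix z assume "z \<in> Q ` Y"
      then obtain w where w: "w \<in> Y" "z = Q w" by blast
      \<comment> \<open>The scalar moves to the other side as \<open>cnj c\<close> and is absorbed
        into \<open>w\<close> by complex linearity of \<open>Q\<close> and \<open>T\<close>.\<close>
      then show "inner (k (c *\<^sub>C x)) z = inner (c *\<^sub>C k x) z"
        using x X Y by (simp add: inner_scaleC_left k(3)[symmetric] csubspace_scaleC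
            bops_scaleC[OF Q, symmetric] bops_scaleC[OF T, symmetric])
    qed (use k(1) x X cl in \<open>auto intro: csubspace_intros\<close>)
  next
    show "norm (k x) \<le> C * norm x" if "x \<in> X" for x
      using k(2)[OF that] n(2)[OF that] by simp
  qed (use k(1) in auto)
  then show ?thesis using that k by blast
qed

text \<open>A form version of Douglas factorization: formally \<open>T\<close> is the adjoint of
  \<open>P\<close> times \<open>K\<close> times \<open>Q\<close>. It comes from representing
  \<open>T\<close> through \<open>Q\<close> and then the result through \<open>P\<close>. The last
  clause makes \<open>K\<close> vanish on the orthogonal complement of the image of
  \<open>Q\<close>, which is the normalization required of angle operators.\<close>

lemma form_factorization:
  assumes X: "csubspace X" and Y: "csubspace Y" and P: "P \<in> bops X R" and Q: "Q \<in> bops Y R'"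
    and T: "T \<in> bops Y R''" and M: "M \<ge> 0"
    and bound: "\<And>x y. x \<in> X \<Longrightarrow> y \<in> Y \<Longrightarrow> \<bar>inner (T y) x\<bar> \<le> M * norm (P x) * norm (Q y)"
  shows "\<exists>K\<in>bops UNIV (closure (P ` X)). (\<forall>v. norm (K v) \<le> M * norm v) \<and>
    (\<forall>x\<in>X. \<forall>y\<in>Y. inner (T y) x = inner (K (Q y)) (P x)) \<and>
    (\<forall>v. (\<forall>y\<in>Y. inner v (Q y) = 0) \<longrightarrow> K v = 0)"
proof -
  obtain C where C: "\<And>x. x \<in> X \<Longrightarrow> norm (P x) \<le> C * norm x"
    using bops_bound[OF P] by metis
  obtain k where k: "k \<in> bops X (closure (Q ` Y))" "\<And>x. x \<in> X \<Longrightarrow> norm (k x) \<le> M * norm (P x)"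
    "\<And>x y. x \<in> X \<Longrightarrow> y \<in> Y \<Longrightarrow> inner x (T y) = inner (k x) (Q y)"
  proof (rule form_representation[OF X Y Q T, of "\<lambda>x. M * norm (P x)" "M * C"])
    show "M * norm (P x) \<le> M * C * norm x" if "x \<in> X" for x
      using mult_left_mono[OF C[OF that] M] by (simp add: mult.assoc)
  qed (use bound M in \<open>auto simp: inner_commute\<close>)
  obtain K where K: "K \<in> bops UNIV (closure (P ` X))" "\<And>v. norm (K v) \<le> M * norm v"
    "\<And>v x. x \<in> X \<Longrightarrow> inner v (k x) = inner (K v) (P x)"
  \<comment> \<open>The roles change here: \<open>P\<close> takes the place of \<open>Q\<close>,
    \<open>k\<close> that of \<open>T\<close>, and the free vector ranges over the whole
    space.\<close>
  proof (rule form_representation[OF csubspace_UNIV X P k(1), of "\<lambda>v. M * norm v" M])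
    show "\<bar>inner v (k x)\<bar> \<le> M * norm v * norm (P x)" if "x \<in> X" for v x
      using Cauchy_Schwarz_ineq2[of v "k x"] mult_left_mono[OF k(2)[OF that] norm_ge_zero[of v]]
      by (simp add: algebra_simps)
  qed (use M in auto)
  show ?thesis
  proof (intro bexI[OF _ K(1)] conjI allI ballI impI)
    show "norm (K v) \<le> M * norm v" for v by (rule K(2))
    show "inner (T y) x = inner (K (Q y)) (P x)" if "x \<in> X" "y \<in> Y" for x y
      using K(3)[OF that(1), of "Q y"] k(3)[OF that] by (simp add: inner_commute)
  next
    fix v assume v: "\<forall>y\<in>Y. inner v (Q y) = 0"
    \<comment> \<open>The values of \<open>k\<close> lie in the closure of the image of
      \<open>Q\<close>, to which \<open>v\<close> is orthogonal.\<close>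
    have "inner v (k x) = 0" if "x \<in> X" for x
      using inner_closure_eq[OF bops_in[OF k(1) that], of v 0] v by auto
    then show "K v = 0"
      using K(3) csubspace_image[OF X P]
      by (intro closure_inner_eqI[of "P ` X"]) (auto intro: bops_in[OF K(1)] csubspace_0 csubspace_closure)
  qed
qed

section \<open>Adjoints and positive operators\<close>

text \<open>Representation through the identity gives the adjoint for the real inner product;
  complex linearity of \<open>X\<close> upgrades it to the complex one. This justifies the
  description in \<open>adj\<close>.\<close>

lemma adj_ex1:
  assumes "X \<in> bops UNIV UNIV"
  shows "\<exists>!Y. Y \<in> bops UNIV UNIV \<and> (\<forall>x y. cinner (X x) y = cinner x (Y y))"
proof -
  obtain M where M: "M \<ge> 0" "\<And>x. norm (X x) \<le> M * norm x"
    using bops_bound[OF assms] by (metis UNIV_I)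
  obtain Y where "Y \<in> bops UNIV (closure ((\<lambda>x. x) ` UNIV))"
    and eq: "\<And>y x. inner y (X x) = inner (Y y) x"
  proof (rule form_representation[OF csubspace_UNIV csubspace_UNIV bops_id[of UNIV UNIV] assms,
        of "\<lambda>y. M * norm y" M])
    show "\<bar>inner y (X x)\<bar> \<le> M * norm y * norm x" for x y
      using Cauchy_Schwarz_ineq2[of y "X x"] mult_left_mono[OF M(2)[of x] norm_ge_zero[of y]]
      by (simp add: algebra_simps)
  qed (use M in auto)
  then have Y: "Y \<in> bops UNIV UNIV"
    by simp
  have "cinner (X x) y = cinner x (Y y)" for x y
    using eq[of y] by (intro cinner_eqI) (auto simp: inner_commute bops_scaleC[OF assms, symmetric])
  moreover have "Z = Y" if "\<forall>x y. cinner (X x) y = cinner x (Z y)" for Z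
  proof
    fix y
    have "inner x (Z y) = inner x (Y y)" for x
      using that eq[of y x] by (metis Re_cinner inner_commute)
    then show "Z y = Y y" by (metis vector_eq_ldot)
  qed
  ultimately show ?thesis using Y by blast
qed

lemma adj_bops: "X \<in> bops UNIV UNIV \<Longrightarrow> adj X \<in> bops UNIV UNIV"
  and cinner_adj: "X \<in> bops UNIV UNIV \<Longrightarrow> cinner (X x) y = cinner x (adj X y)"
  unfolding adj_def by (drule theI'[OF adj_ex1], blast)+

lemma inner_adj: "X \<in> bops UNIV UNIV \<Longrightarrow> inner (X x) y = inner x (adj X y)"
  by (metis cinner_adj Re_cinner)

lemma inner_adj': "X \<in> bops UNIV UNIV \<Longrightarrow> inner (adj X x) y = inner x (X y)"
  by (metis inner_adj inner_commute)

lemma adj_eqI: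
  assumes "X \<in> bops UNIV UNIV" "\<And>x y. inner (X x) y = inner x (Y y)"
  shows "adj X = Y"
proof
  show "adj X y = Y y" for y
    using assms by (metis inner_adj vector_eq_ldot)
qed

lemma selfadjointI:
  "A \<in> bops UNIV UNIV \<Longrightarrow> (\<And>x y. inner (A x) y = inner x (A y)) \<Longrightarrow> selfadjoint A"
  by (simp add: selfadjoint_def adj_eqI)

lemma selfadjoint_inner: "selfadjoint A \<Longrightarrow> inner (A x) y = inner x (A y)"
  by (metis selfadjoint_def inner_adj)

lemma norm_adj_le:
  assumes X: "X \<in> bops UNIV UNIV" and le: "\<And>x. norm (X x) \<le> norm x"
  shows "norm (adj X x) \<le> norm x"
proof -
  have "norm (adj X x) * norm (adj X x) = inner (X (adj X x)) x"
    by (simp add: inner_adj[OF X] power2_norm_eq_inner flip: power2_eq_square)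
  also have "\<dots> \<le> norm (adj X x) * norm x"
    using Cauchy_Schwarz_ineq2[of "X (adj X x)" x]
      mult_right_mono[OF le[of "adj X x"] norm_ge_zero[of x]] by linarith
  finally show ?thesis
    by (cases "adj X x = 0") auto
qed

text \<open>Polarization and the parallelogram law bound the mixed form by half the sum of the two
  squares; rescaling one vector by a real \<open>t\<close> and taking the discriminant yields the
  product. No constant is lost, so the angle operators become contractions.\<close>

lemma symmetric_form_bound:
  assumes S: "csubspace S" and G: "G \<in> bops S R" and D: "D \<in> bops S R'"
    and sym: "\<And>x y. x \<in> S \<Longrightarrow> y \<in> S \<Longrightarrow> inner (G x) y = inner x (G y)"
    and bound: "\<And>x. x \<in> S \<Longrightarrow> \<bar>inner (G x) x\<bar> \<le> (norm (D x))\<^sup>2"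
    and x: "x \<in> S" and y: "y \<in> S"
  shows "\<bar>inner (G x) y\<bar> \<le> norm (D x) * norm (D y)"
proof -
  have bound': "2 * inner (G u) v \<le> (norm (D u))\<^sup>2 + (norm (D v))\<^sup>2" if "u \<in> S" "v \<in> S" for u v
  proof -
    have "inner (G (u + v)) (u + v) - inner (G (u - v)) (u - v) = 4 * inner (G u) v"
      using that S sym[OF that] by (simp add: bops_lin[OF G] bops_diff[OF G S] bops_add[OF G]
          inner_simps inner_commute)
    moreover have "(norm (D (u + v)))\<^sup>2 + (norm (D (u - v)))\<^sup>2 = 2 * (norm (D u))\<^sup>2 + 2 * (norm (D v))\<^sup>2"
      using that S by (simp add: bops_diff[OF D S] bops_add[OF D] power2_norm_eq_inner inner_simps
          inner_commute)
    moreover have "\<bar>inner (G (u + v)) (u + v)\<bar> \<le> (norm (D (u + v)))\<^sup>2"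
      "\<bar>inner (G (u - v)) (u - v)\<bar> \<le> (norm (D (u - v)))\<^sup>2"
      using that S by (auto intro!: bound csubspace_intros)
    ultimately show ?thesis by linarith
  qed
  have "(- inner (G x) y)\<^sup>2 \<le> (norm (D x))\<^sup>2 * (norm (D y))\<^sup>2"
  proof (rule quad_nonneg)
    show "0 \<le> (norm (D x))\<^sup>2 * t\<^sup>2 + 2 * - inner (G x) y * t + (norm (D y))\<^sup>2" for t
      using bound'[OF csubspace_scaleR[OF S x, of t] y] x
      by (simp add: bops_scaleR[OF G] bops_scaleR[OF D] power_mult_distrib algebra_simps)
  qed simp
  then have "\<bar>inner (G x) y\<bar>\<^sup>2 \<le> (norm (D x) * norm (D y))\<^sup>2"
    by (simp add: power_mult_distrib)
  then show ?thesis
    by (rule power2_le_imp_le) simp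
qed

text \<open>On a complex space a real quadratic form is automatically symmetric, by polarization
  with \<open>\<i>\<close>. The right-hand side is the working form of positivity.\<close>

lemma positive_on_iff:
  assumes S: "csubspace S"
  shows "positive_on S A \<longleftrightarrow> A \<in> bops S S \<and> (\<forall>x\<in>S. \<forall>y\<in>S. inner (A x) y = inner x (A y)) \<and>
    (\<forall>x\<in>S. 0 \<le> inner (A x) x)"
proof (intro iffI conjI ballI)
  assume pos: "positive_on S A"
  then show A: "A \<in> bops S S" by (simp add: positive_on_def)
  have real: "inner (\<i> *\<^sub>C A x) x = 0" if "x \<in> S" for x
    using pos that Im_cinner[of "A x" x]
    by (auto simp: positive_on_def complex_nonneg_Reals_iff)
  show "inner (A x) y = inner x (A y)" if xy: "x \<in> S" "y \<in> S" for x y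
  proof -
    \<comment> \<open>After expansion the two diagonal terms vanish by \<open>real\<close>; the
      cross terms are \<open>inner (A y) x\<close> and \<open>- inner (A x) y\<close>.\<close>
    have "inner (\<i> *\<^sub>C A (y + \<i> *\<^sub>C x)) (y + \<i> *\<^sub>C x) = 0"
      using xy S by (intro real csubspace_intros)
    then show ?thesis
      using xy S real[OF xy(1)] real[OF xy(2)] inner_ii_left[of "A x" x]
      by (simp add: bops_add[OF A] bops_scaleC[OF A] csubspace_intros scaleC_add_right inner_simps
          inner_ii_left[of "A x"] inner_commute)
  qed
  show "0 \<le> inner (A x) x" if "x \<in> S" for x
    using pos that by (auto simp: positive_on_def complex_nonneg_Reals_iff Re_cinner)
next
  assume A: "A \<in> bops S S \<and> (\<forall>x\<in>S. \<forall>y\<in>S. inner (A x) y = inner x (A y)) \<and>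
    (\<forall>x\<in>S. 0 \<le> inner (A x) x)"
  have "cinner (A x) x \<in> \<real>\<^sub>\<ge>\<^sub>0" if x: "x \<in> S" for x
  proof -
    have "inner (\<i> *\<^sub>C A x) x = inner (A (\<i> *\<^sub>C x)) x"
      using bops_scaleC[of A S S x] A x by auto
    also have "\<dots> = inner (\<i> *\<^sub>C x) (A x)"
      using A x S by (simp add: csubspace_scaleC)
    also have "\<dots> = - inner (\<i> *\<^sub>C A x) x"
      using inner_ii_left[of x "A x"] by (metis inner_commute)
    finally have "inner (\<i> *\<^sub>C A x) x = 0" by simp
    moreover have "0 \<le> inner (A x) x" using A x by blast
    ultimately show ?thesis
      by (simp add: complex_nonneg_Reals_iff Re_cinner Im_cinner)
  qed
  then show "positive_on S A" using A by (simp add: positive_on_def)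
qed

text \<open>Cauchy-Schwarz for the semidefinite form of \<open>B\<close>, applied to
  \<open>y\<close> and \<open>B y\<close>, bounds a power of the norm of \<open>B y\<close> by
  0.\<close>

lemma positive_on_kernel:
  assumes S: "csubspace S" and B: "positive_on S B" and y: "y \<in> S" and 0: "inner (B y) y = 0"
  shows "B y = 0"
proof -
  have BS: "B \<in> bops S S" and sym: "\<And>x y. x \<in> S \<Longrightarrow> y \<in> S \<Longrightarrow> inner (B x) y = inner x (B y)"
    and pos: "\<And>x. x \<in> S \<Longrightarrow> 0 \<le> inner (B x) x"
    using B by (auto simp: positive_on_iff[OF S])
  let ?z = "B y"
  have z: "?z \<in> S" using BS y by (rule bops_in)
  have "(inner (B y) ?z)\<^sup>2 \<le> inner (B ?z) ?z * 0"
  proof (rule quad_nonneg)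
    show "0 \<le> inner (B ?z) ?z * t\<^sup>2 + 2 * inner (B y) ?z * t + 0" for t
      using pos[of "y + t *\<^sub>R ?z"] y z S sym[OF z y] 0
      by (simp add: csubspace_intros bops_add[OF BS] bops_scaleR[OF BS] inner_simps inner_commute
          power2_eq_square algebra_simps)
  qed (use pos z in auto)
  then show ?thesis by simp
qed

section \<open>Square roots of positive operators\<close>

text \<open>The iteration \<open>Y \<leftarrow> (R + Y\<^sup>2) / 2\<close> for \<open>I - (I - R)\<^sup>1\<^sup>/\<^sup>2\<close>. For \<open>\<parallel>R\<parallel> \<le> 1\<close> it is majorized by the
  same scalar iteration with \<open>R = 1\<close>, whence convergence in norm.\<close>

primrec sqrt_iter :: "('a::chilbert_space \<Rightarrow> 'a) \<Rightarrow> nat \<Rightarrow> 'a \<Rightarrow> 'a"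
  where "sqrt_iter R 0 = (\<lambda>x. 0)"
  | "sqrt_iter R (Suc n) = (\<lambda>x. (1/2) *\<^sub>R (R x + sqrt_iter R n (sqrt_iter R n x)))"

primrec sqrt_majorant :: "nat \<Rightarrow> real"
  where "sqrt_majorant 0 = 0"
  | "sqrt_majorant (Suc n) = (1 + (sqrt_majorant n)\<^sup>2) / 2"

lemma sqrt_majorant_range: "0 \<le> sqrt_majorant n \<and> sqrt_majorant n \<le> 1"
  by (induction n) (auto simp: power_le_one)

lemma sqrt_majorant_mono: "sqrt_majorant n \<le> sqrt_majorant (Suc n)"
proof -
  have "0 \<le> (1 - sqrt_majorant n)\<^sup>2" by simp
  then show ?thesis by (simp add: power2_diff)
qed

text \<open>A bounded increasing sequence converges, so its increments are summable. They will
  dominate the increments of the operator iteration.\<close>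

lemma summable_sqrt_majorant: "summable (\<lambda>n. sqrt_majorant (Suc n) - sqrt_majorant n)"
proof -
  have "convergent sqrt_majorant"
  proof (rule Bseq_mono_convergent[OF BseqI'[of _ 1]])
    show "\<forall>m n. m \<le> n \<longrightarrow> sqrt_majorant m \<le> sqrt_majorant n"
      using lift_Suc_mono_le[of sqrt_majorant, OF sqrt_majorant_mono] by blast
  qed (use sqrt_majorant_range in simp)
  then show ?thesis
    using telescope_summable by (metis convergent_def)
qed

section \<open>Convergence of the square root iteration\<close>

context
  fixes S :: "'a::chilbert_space set" and R :: "'a \<Rightarrow> 'a"
  assumes S: "csubspace S" and closed_S: "closed S" and R: "R \<in> bops S S"
    and R_le: "\<And>x. x \<in> S \<Longrightarrow> norm (R x) \<le> norm x"
begin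

lemma sqrt_iter_bops: "sqrt_iter R n \<in> bops S S"
proof (induction n)
  case 0
  show ?case by (auto simp: bops_def csubspace_0 S intro: exI[of _ 0])
next
  case (Suc n)
  then show ?case
    using bops_scaleR_left[OF S bops_plus[OF S R bops_comp[OF Suc Suc]], of "1/2"] by simp
qed

lemma sqrt_iter_le: "x \<in> S \<Longrightarrow> norm (sqrt_iter R n x) \<le> sqrt_majorant n * norm x"
proof (induction n arbitrary: x)
  case (Suc n)
  have "norm (sqrt_iter R n (sqrt_iter R n x)) \<le> sqrt_majorant n * norm (sqrt_iter R n x)"
    using Suc bops_in[OF sqrt_iter_bops] by blast
  also have "\<dots> \<le> sqrt_majorant n * (sqrt_majorant n * norm x)"
    using Suc sqrt_majorant_range by (intro mult_left_mono) auto
  finally show ?case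
    using R_le[OF Suc.prems] norm_triangle_ineq[of "R x" "sqrt_iter R n (sqrt_iter R n x)"]
    by (simp add: power2_eq_square distrib_right mult.assoc del: scaleR_add_right)
qed simp

lemma sqrt_iter_le_1: "x \<in> S \<Longrightarrow> norm (sqrt_iter R n x) \<le> norm x"
  using sqrt_iter_le[of x n] sqrt_majorant_range[of n] mult_right_mono[of "sqrt_majorant n" 1 "norm x"]
  by simp

text \<open>For consecutive iterates \<open>Y\<close> and \<open>Y'\<close> the difference of
  squares is \<open>Y' (Y' - Y) + (Y' - Y) Y\<close>, an identity that asks for no commutation. The
  same identity for the scalar iterates makes the bound reproduce itself exactly.\<close>

lemma sqrt_iter_diff_le:
  "x \<in> S \<Longrightarrow> norm (sqrt_iter R (Suc n) x - sqrt_iter R n x) \<le>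
    (sqrt_majorant (Suc n) - sqrt_majorant n) * norm x"
proof (induction n arbitrary: x)
  case 0
  then show ?case using R_le by simp
next
  case (Suc n)
  define Y Y' y y' where defs: "Y = sqrt_iter R n" "Y' = sqrt_iter R (Suc n)"
    "y = sqrt_majorant n" "y' = sqrt_majorant (Suc n)"
  have bops: "Y \<in> bops S S" "Y' \<in> bops S S" unfolding defs by (rule sqrt_iter_bops)+
  have in_S: "Y u \<in> S" "Y' u \<in> S" if "u \<in> S" for u
    using that bops_in[OF bops(1)] bops_in[OF bops(2)] by auto
  have IH: "norm (Y' u - Y u) \<le> (y' - y) * norm u" if "u \<in> S" for u
    using Suc.IH[OF that] unfolding defs .
  have y: "0 \<le> y" "0 \<le> y'" "y \<le> y'"
    using sqrt_majorant_range sqrt_majorant_mono unfolding defs by auto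
  have "norm (Y' (Y' x - Y x)) \<le> y' * norm (Y' x - Y x)"
    unfolding defs(2,4) by (rule sqrt_iter_le) (intro csubspace_diff S in_S[unfolded defs(2)] Suc.prems)
  also have "\<dots> \<le> y' * ((y' - y) * norm x)"
    using y IH[OF Suc.prems] by (intro mult_left_mono)
  finally have 1: "norm (Y' (Y' x - Y x)) \<le> y' * ((y' - y) * norm x)" .
  have "norm (Y' (Y x) - Y (Y x)) \<le> (y' - y) * norm (Y x)"
    by (intro IH in_S Suc.prems)
  also have "\<dots> \<le> (y' - y) * (y * norm x)"
    unfolding defs(1) defs(3)[symmetric]
    using y sqrt_iter_le[OF Suc.prems, of n] by (intro mult_left_mono) (auto simp: defs)
  finally have 2: "norm (Y' (Y x) - Y (Y x)) \<le> (y' - y) * (y * norm x)" .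
  have "sqrt_iter R (Suc (Suc n)) x - sqrt_iter R (Suc n) x =
      (1/2) *\<^sub>R (R x + Y' (Y' x)) - (1/2) *\<^sub>R (R x + Y (Y x))"
    unfolding defs by simp
  also have "\<dots> = (1/2) *\<^sub>R (Y' (Y' x - Y x) + (Y' (Y x) - Y (Y x)))"
    using in_S Suc.prems S by (simp add: bops_diff[OF bops(2) S] algebra_simps)
  finally have "norm (sqrt_iter R (Suc (Suc n)) x - sqrt_iter R (Suc n) x) \<le>
      (1/2) * (y' * ((y' - y) * norm x) + (y' - y) * (y * norm x))"
    using norm_triangle_ineq[of "Y' (Y' x - Y x)" "Y' (Y x) - Y (Y x)"] 1 2 by simp
  also have "\<dots> = ((1 + y'\<^sup>2) / 2 - (1 + y\<^sup>2) / 2) * norm x"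
    by (simp add: power2_eq_square algebra_simps)
  also have "\<dots> = (sqrt_majorant (Suc (Suc n)) - sqrt_majorant (Suc n)) * norm x"
    unfolding defs by simp
  finally show ?case .
qed

text \<open>Iterates are polynomials in \<open>R\<close>. In the limit this supplies the commutation
  on which uniqueness of square roots rests.\<close>

lemma sqrt_iter_commute:
  assumes C: "C \<in> bops S S" "\<And>x. x \<in> S \<Longrightarrow> C (R x) = R (C x)" and x: "x \<in> S"
  shows "C (sqrt_iter R n x) = sqrt_iter R n (C x)"
  using x
proof (induction n arbitrary: x)
  case 0
  then show ?case using S C by (simp add: bops_0)
next
  case (Suc n)
  have in_S: "sqrt_iter R n u \<in> S" "R u \<in> S" if "u \<in> S" for u
    using that bops_in[OF sqrt_iter_bops] bops_in[OF R] by auto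
  show ?case
    using Suc.prems in_S C(2)
    by (simp add: bops_scaleR[OF C(1)] bops_add[OF C(1)] csubspace_add[OF S] Suc.IH)
qed

lemma sqrt_iter_sym:
  assumes "\<And>x y. x \<in> S \<Longrightarrow> y \<in> S \<Longrightarrow> inner (R x) y = inner x (R y)" "x \<in> S" "y \<in> S"
  shows "inner (sqrt_iter R n x) y = inner x (sqrt_iter R n y)"
  using assms(2,3)
proof (induction n arbitrary: x y)
  case (Suc n)
  have in_S: "sqrt_iter R n u \<in> S" if "u \<in> S" for u
    using that bops_in[OF sqrt_iter_bops] by auto
  show ?case using Suc.prems in_S by (simp add: inner_simps assms(1) Suc.IH)
qed simp

definition sqrt_lim :: "'a \<Rightarrow> 'a"
  where "sqrt_lim = (\<lambda>x. lim (\<lambda>n. sqrt_iter R n x))"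

lemma sqrt_iter_tendsto:
  assumes x: "x \<in> S"
  shows "(\<lambda>n. sqrt_iter R n x) \<longlonglongrightarrow> sqrt_lim x"
proof -
  have "summable (\<lambda>n. sqrt_iter R (Suc n) x - sqrt_iter R n x)"
    by (rule summable_comparison_test'[OF summable_mult2[OF summable_sqrt_majorant, of "norm x"]])
      (use sqrt_iter_diff_le[OF x] in simp)
  then obtain s where "(\<lambda>n. \<Sum>k<n. sqrt_iter R (Suc k) x - sqrt_iter R k x) \<longlonglongrightarrow> s"
    using summable_LIMSEQ by blast
  then have "(\<lambda>n. sqrt_iter R n x) \<longlonglongrightarrow> s"
    unfolding sum_lessThan_telescope[of "\<lambda>k. sqrt_iter R k x"] by simp
  then show ?thesis unfolding sqrt_lim_def by (simp add: limI)
qed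

lemma sqrt_lim_in: "x \<in> S \<Longrightarrow> sqrt_lim x \<in> S"
  by (rule closed_sequentially[OF closed_S _ sqrt_iter_tendsto]) (rule bops_in[OF sqrt_iter_bops])

lemma sqrt_lim_le: "x \<in> S \<Longrightarrow> norm (sqrt_lim x) \<le> norm x"
  by (rule LIMSEQ_le_const2[OF tendsto_norm[OF sqrt_iter_tendsto]]) (auto intro: sqrt_iter_le_1)

lemma sqrt_lim_bops: "sqrt_lim \<in> bops S S"
proof (rule bopsI[where M = 1])
  show "sqrt_lim (x + y) = sqrt_lim x + sqrt_lim y" if "x \<in> S" "y \<in> S" for x y
  proof (rule LIMSEQ_unique[OF sqrt_iter_tendsto])
    show "x + y \<in> S" using that S by (rule csubspace_add[rotated 1])
    show "(\<lambda>n. sqrt_iter R n (x + y)) \<longlonglongrightarrow> sqrt_lim x + sqrt_lim y"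
      using tendsto_add[OF sqrt_iter_tendsto[OF that(1)] sqrt_iter_tendsto[OF that(2)]]
      by (simp add: bops_add[OF sqrt_iter_bops] that)
  qed
  show "sqrt_lim (c *\<^sub>C x) = c *\<^sub>C sqrt_lim x" if "x \<in> S" for c x
  proof (rule LIMSEQ_unique[OF sqrt_iter_tendsto])
    show "c *\<^sub>C x \<in> S" using that S by (simp add: csubspace_scaleC)
    show "(\<lambda>n. sqrt_iter R n (c *\<^sub>C x)) \<longlonglongrightarrow> c *\<^sub>C sqrt_lim x"
      using bounded_linear.tendsto[OF bounded_linear_scaleC sqrt_iter_tendsto[OF that]]
      by (simp add: bops_scaleC[OF sqrt_iter_bops] that)
  qed
qed (use sqrt_lim_in sqrt_lim_le in auto)

text \<open>In the squared iterate both the outer operator and its argument vary with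
  \<open>n\<close>. The outer operators are contractions uniformly in \<open>n\<close>, so the
  moving argument may be replaced by its limit.\<close>

lemma sqrt_lim_fixpoint:
  assumes x: "x \<in> S"
  shows "2 *\<^sub>R sqrt_lim x = R x + sqrt_lim (sqrt_lim x)"
proof -
  let ?L = "sqrt_lim x"
  have L: "?L \<in> S" using x by (rule sqrt_lim_in)
  have "(\<lambda>n. sqrt_iter R n (sqrt_iter R n x) - sqrt_iter R n ?L) \<longlonglongrightarrow> 0"
  proof (rule Lim_null_comparison)
    have in_S: "sqrt_iter R n x \<in> S" for n using x by (rule bops_in[OF sqrt_iter_bops])
    show "\<forall>\<^sub>F n in sequentially. norm (sqrt_iter R n (sqrt_iter R n x) - sqrt_iter R n ?L) \<le>
        norm (sqrt_iter R n x - ?L)"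
      using sqrt_iter_le_1[OF csubspace_diff[OF S in_S L]]
      by (simp add: bops_diff[OF sqrt_iter_bops S in_S L, symmetric])
    show "(\<lambda>n. norm (sqrt_iter R n x - ?L)) \<longlonglongrightarrow> 0"
      using sqrt_iter_tendsto[OF x] by (simp add: LIM_zero tendsto_norm_zero)
  qed
  from tendsto_add[OF this sqrt_iter_tendsto[OF L]]
  have "(\<lambda>n. sqrt_iter R n (sqrt_iter R n x)) \<longlonglongrightarrow> sqrt_lim ?L" by simp
  then have "(\<lambda>n. sqrt_iter R (Suc n) x) \<longlonglongrightarrow> (1/2) *\<^sub>R (R x + sqrt_lim ?L)"
    unfolding sqrt_iter.simps by (intro tendsto_intros)
  then have "?L = (1/2) *\<^sub>R (R x + sqrt_lim ?L)"
    by (rule LIMSEQ_unique[OF LIMSEQ_Suc[OF sqrt_iter_tendsto[OF x]]])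
  from arg_cong[OF this, of "\<lambda>v. 2 *\<^sub>R v"] show ?thesis by simp
qed

lemma sqrt_lim_commute:
  assumes C: "C \<in> bops S S" "\<And>x. x \<in> S \<Longrightarrow> C (R x) = R (C x)" and x: "x \<in> S"
  shows "C (sqrt_lim x) = sqrt_lim (C x)"
proof -
  obtain M where M: "\<And>x. x \<in> S \<Longrightarrow> norm (C x) \<le> M * norm x"
    using bops_bound[OF C(1)] by metis
  have in_S: "sqrt_iter R n x \<in> S" for n using x by (rule bops_in[OF sqrt_iter_bops])
  have "(\<lambda>n. C (sqrt_iter R n x) - C (sqrt_lim x)) \<longlonglongrightarrow> 0"
  proof (rule Lim_null_comparison)
    show "\<forall>\<^sub>F n in sequentially. norm (C (sqrt_iter R n x) - C (sqrt_lim x)) \<le>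
        M * norm (sqrt_iter R n x - sqrt_lim x)"
      using M[OF csubspace_diff[OF S in_S sqrt_lim_in[OF x]]]
      by (simp add: bops_diff[OF C(1) S in_S sqrt_lim_in[OF x], symmetric])
    show "(\<lambda>n. M * norm (sqrt_iter R n x - sqrt_lim x)) \<longlonglongrightarrow> 0"
      using sqrt_iter_tendsto[OF x] by (intro tendsto_mult_right_zero) (simp add: LIM_zero tendsto_norm_zero)
  qed
  then have "(\<lambda>n. sqrt_iter R n (C x)) \<longlonglongrightarrow> C (sqrt_lim x)"
    by (simp add: sqrt_iter_commute[OF C x] LIM_zero_iff)
  then show ?thesis
    by (rule LIMSEQ_unique) (rule sqrt_iter_tendsto[OF bops_in[OF C(1) x]])
qed

lemma sqrt_lim_sym:
  assumes "\<And>x y. x \<in> S \<Longrightarrow> y \<in> S \<Longrightarrow> inner (R x) y = inner x (R y)" "x \<in> S" "y \<in> S"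
  shows "inner (sqrt_lim x) y = inner x (sqrt_lim y)"
proof (rule LIMSEQ_unique)
  show "(\<lambda>n. inner (sqrt_iter R n x) y) \<longlonglongrightarrow> inner (sqrt_lim x) y"
    by (rule tendsto_inner[OF sqrt_iter_tendsto[OF assms(2)] tendsto_const])
  show "(\<lambda>n. inner (sqrt_iter R n x) y) \<longlonglongrightarrow> inner x (sqrt_lim y)"
    using sqrt_iter_sym[OF assms] by (simp add: tendsto_inner sqrt_iter_tendsto[OF assms(3)])
qed

end

section \<open>Existence and uniqueness of the positive square root\<close>

text \<open>Scaling reduces to the iteration: \<open>R\<close>, the identity minus
  \<open>A / M\<close>, is a contraction for large \<open>M\<close>, and if \<open>Y\<close> is the
  limit for \<open>R\<close> then \<open>sqrt M\<close> times the identity minus \<open>Y\<close>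
  squares to \<open>A\<close>. The commutation clause prepares uniqueness.\<close>

lemma sqrt_on_exists:
  assumes S: "csubspace S" "closed S" and A: "positive_on S A"
  obtains B where "positive_on S B" "\<forall>x\<in>S. B (B x) = A x" "\<forall>x. x \<notin> S \<longrightarrow> B x = 0"
    "\<forall>C\<in>bops S S. (\<forall>x\<in>S. C (A x) = A (C x)) \<longrightarrow> (\<forall>x\<in>S. C (B x) = B (C x))"
proof -
  have AS: "A \<in> bops S S" and sym: "\<And>x y. x \<in> S \<Longrightarrow> y \<in> S \<Longrightarrow> inner (A x) y = inner x (A y)"
    and pos: "\<And>x. x \<in> S \<Longrightarrow> 0 \<le> inner (A x) x"
    using A by (auto simp: positive_on_iff[OF S(1)])
  obtain M0 where M0: "M0 \<ge> 0" "\<And>x. x \<in> S \<Longrightarrow> norm (A x) \<le> M0 * norm x"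
    using bops_bound[OF AS] by metis
  \<comment> \<open>Adding 1 makes the bound strictly positive, so that division by it is possible
    even for \<open>A = 0\<close>.\<close>
  define M where "M = M0 + 1"
  have M: "M > 0" "\<And>x. x \<in> S \<Longrightarrow> norm (A x) \<le> M * norm x"
    using M0 by (auto simp: M_def algebra_simps intro: order_trans[OF M0(2)])
  define R where "R = (\<lambda>x. x - (1 / M) *\<^sub>R A x)"
  have R: "R \<in> bops S S"
    unfolding R_def by (intro bops_minus bops_scaleR_left bops_id AS S order_refl)
  have R_sym: "inner (R x) y = inner x (R y)" if "x \<in> S" "y \<in> S" for x y
    using sym[OF that] by (simp add: R_def inner_simps)
  have R_le: "norm (R x) \<le> norm x" if x: "x \<in> S" for x
  proof -
    have "\<bar>inner (R u) u\<bar> \<le> (norm u)\<^sup>2" if u: "u \<in> S" for u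
    proof -
      have "inner (A u) u \<le> M * (norm u)\<^sup>2"
        using Cauchy_Schwarz_ineq2[of "A u" u] mult_right_mono[OF M(2)[OF u] norm_ge_zero[of u]]
        by (simp add: power2_eq_square)
      then have "(1 / M) * inner (A u) u \<le> (norm u)\<^sup>2"
        using M(1) by (simp add: field_simps)
      moreover have "0 \<le> (1 / M) * inner (A u) u"
        using M(1) pos[OF u] by simp
      ultimately show ?thesis
        by (simp add: R_def inner_simps power2_norm_eq_inner)
    qed
    \<comment> \<open>The bound on the quadratic form becomes a norm bound by
      \<open>symmetric_form_bound\<close> with the identity in place of \<open>D\<close>, tested on
      \<open>x\<close> and \<open>R x\<close>.\<close>
    then have "\<bar>inner (R x) (R x)\<bar> \<le> norm x * norm (R x)"
      using x by (intro symmetric_form_bound[OF S(1) R bops_id[of S UNIV] R_sym]) (auto intro: bops_in[OF R])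
    then have "norm (R x) * norm (R x) \<le> norm x * norm (R x)"
      by (simp add: power2_norm_eq_inner flip: power2_eq_square)
    then show ?thesis by (cases "R x = 0") auto
  qed
  note ctx = S R R_le
  define Y where "Y = sqrt_lim R"
  note Y_bops = sqrt_lim_bops[OF ctx, folded Y_def]
  define B0 where "B0 = (\<lambda>x. sqrt M *\<^sub>R (x - Y x))"
  define B where "B = (\<lambda>x. if x \<in> S then B0 x else 0)"
  have B0: "B0 \<in> bops S S"
    unfolding B0_def by (intro bops_minus bops_scaleR_left bops_id Y_bops S order_refl)
  have B_bops: "B \<in> bops S S"
    using B0 S(1) unfolding bops_def by (auto simp: B_def csubspace_intros)
  show ?thesis
  proof
    show "positive_on S B"
      unfolding positive_on_iff[OF S(1)]
    proof (intro conjI ballI B_bops)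
      fix x assume x: "x \<in> S"
      show "inner (B x) y = inner x (B y)" if "y \<in> S" for y
        using sqrt_lim_sym[OF ctx R_sym x that] x that
        by (simp add: B_def B0_def inner_simps Y_def)
      have "inner (Y x) x \<le> norm x * norm x"
        using Cauchy_Schwarz_ineq2[of "Y x" x] sqrt_lim_le[OF ctx x]
          mult_right_mono[of "norm (Y x)" "norm x" "norm x"] by (simp add: Y_def)
      then show "0 \<le> inner (B x) x"
        using x M(1) by (simp add: B_def B0_def inner_simps power2_norm_eq_inner flip: power2_eq_square)
    qed
    show "\<forall>x\<in>S. B (B x) = A x"
    proof
      fix x assume x: "x \<in> S"
      have in_S: "Y x \<in> S" "B0 x \<in> S" using x Y_bops B0 by (auto intro: bops_in)
      have "B (B x) = M *\<^sub>R (x - Y x - (Y x - Y (Y x)))"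
        using x in_S S M(1)
        by (simp add: B_def) (simp add: B0_def bops_scaleR[OF Y_bops] bops_diff[OF Y_bops S(1)]
            csubspace_intros flip: scaleR_diff_right)
      also have "\<dots> = M *\<^sub>R (x - (2 *\<^sub>R Y x - Y (Y x)))"
        by (simp add: scaleR_2 algebra_simps)
      \<comment> \<open>The fixed point equation identifies \<open>2 *\<^sub>R Y x - Y (Y x)\<close>
        with \<open>R x\<close>, and \<open>M *\<^sub>R (x - R x)\<close> is
        \<open>A x\<close>.\<close>
      also have "\<dots> = A x"
        using sqrt_lim_fixpoint[OF ctx x] M(1) by (simp add: Y_def R_def)
      finally show "B (B x) = A x" .
    qed
    show "\<forall>x. x \<notin> S \<longrightarrow> B x = 0" by (simp add: B_def)
    show "\<forall>C\<in>bops S S. (\<forall>x\<in>S. C (A x) = A (C x)) \<longrightarrow> (\<forall>x\<in>S. C (B x) = B (C x))"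
    proof (intro ballI impI)
      fix C x assume C: "C \<in> bops S S" "\<forall>x\<in>S. C (A x) = A (C x)" and x: "x \<in> S"
      have CR: "C (R u) = R (C u)" if "u \<in> S" for u
        using that S(1) by (simp add: R_def bops_diff[OF C(1) S(1)] bops_scaleR[OF C(1)] csubspace_intros
            bops_in[OF AS] C(2))
      show "C (B x) = B (C x)"
        using sqrt_lim_commute[OF ctx C(1) CR x] x bops_in[OF C(1) x] S(1) bops_in[OF Y_bops x]
        by (simp add: B_def B0_def bops_scaleR[OF C(1)] bops_diff[OF C(1) S(1)] csubspace_intros Y_def)
    qed
  qed
qed

text \<open>A second root \<open>C\<close> commutes with \<open>A = C\<^sup>2\<close>, hence with \<open>B\<close>; then \<open>(B + C) (B - C) = 0\<close>.\<close>

lemma sqrt_on_ex1: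
  assumes S: "csubspace S" "closed S" and A: "positive_on S A"
  shows "\<exists>!B. positive_on S B \<and> (\<forall>x\<in>S. B (B x) = A x) \<and> (\<forall>x. x \<notin> S \<longrightarrow> B x = 0)"
proof -
  obtain B where B: "positive_on S B" "\<forall>x\<in>S. B (B x) = A x" "\<forall>x. x \<notin> S \<longrightarrow> B x = 0"
    and comm: "\<forall>C\<in>bops S S. (\<forall>x\<in>S. C (A x) = A (C x)) \<longrightarrow> (\<forall>x\<in>S. C (B x) = B (C x))"
    by (rule sqrt_on_exists[OF assms])
  have "C = B" if C: "positive_on S C" "\<forall>x\<in>S. C (C x) = A x" "\<forall>x. x \<notin> S \<longrightarrow> C x = 0" for C
  proof
    fix x
    have BS: "B \<in> bops S S" and CS: "C \<in> bops S S"
      and symB: "\<And>x y. x \<in> S \<Longrightarrow> y \<in> S \<Longrightarrow> inner (B x) y = inner x (B y)"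
      and symC: "\<And>x y. x \<in> S \<Longrightarrow> y \<in> S \<Longrightarrow> inner (C x) y = inner x (C y)"
      and posB: "\<And>x. x \<in> S \<Longrightarrow> 0 \<le> inner (B x) x"
      and posC: "\<And>x. x \<in> S \<Longrightarrow> 0 \<le> inner (C x) x"
      using B(1) C(1) by (auto simp: positive_on_iff[OF S(1)])
    show "C x = B x"
    proof (cases "x \<in> S")
      case x: True
      have in_S: "B u \<in> S" "C u \<in> S" if "u \<in> S" for u
        using that BS CS by (auto intro: bops_in)
      have CA: "C (A u) = A (C u)" if "u \<in> S" for u
        using C(2)[rule_format, OF that] C(2)[rule_format, OF in_S(2)[OF that]] by simp
      let ?y = "B x - C x"
      have y: "?y \<in> S" using x in_S S by (auto intro: csubspace_intros)
      have "B ?y + C ?y = 0"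
        using x in_S B(2) C(2) comm CS CA
        by (simp add: bops_diff[OF BS S(1)] bops_diff[OF CS S(1)])
      then have "inner (B ?y) ?y + inner (C ?y) ?y = 0"
        by (metis inner_add_left inner_zero_left)
      then have "inner (B ?y) ?y = 0" "inner (C ?y) ?y = 0"
        using posB[OF y] posC[OF y] by auto
      then have "B ?y = 0" "C ?y = 0"
        using positive_on_kernel[OF S(1) _ y] B(1) C(1) by auto
      \<comment> \<open>By symmetry \<open>inner ?y ?y\<close> equals
        \<open>inner x (B ?y - C ?y)\<close>.\<close>
      then have "inner ?y ?y = 0"
        using symB[OF x y] symC[OF x y] by (simp add: inner_diff_left)
      then show ?thesis by simp
    qed (use B(3) C(3) in auto)
  qed
  with B show ?thesis by blast
qed

lemma
  assumes "csubspace S" "closed S" "positive_on S A"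
  shows sqrt_on_positive: "positive_on S (sqrt_on S A)"
    and sqrt_on_square: "x \<in> S \<Longrightarrow> sqrt_on S A (sqrt_on S A x) = A x"
  unfolding sqrt_on_def using theI'[OF sqrt_on_ex1[OF assms]] by blast+

lemma sqrt_on_bops: "csubspace S \<Longrightarrow> closed S \<Longrightarrow> positive_on S A \<Longrightarrow> sqrt_on S A \<in> bops S S"
  using sqrt_on_positive[of S A] by (simp add: positive_on_def)

lemma sqrt_on_sym:
  assumes "csubspace S" "closed S" "positive_on S A" "x \<in> S" "y \<in> S"
  shows "inner (sqrt_on S A x) y = inner x (sqrt_on S A y)"
  using sqrt_on_positive[OF assms(1-3)] assms(4,5) unfolding positive_on_iff[OF assms(1)] by blast

lemma norm_sqrt_on:
  assumes "csubspace S" "closed S" "positive_on S A" "x \<in> S"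
  shows "(norm (sqrt_on S A x))\<^sup>2 = inner (A x) x"
  using assms sqrt_on_sym[OF assms bops_in[OF sqrt_on_bops[OF assms(1-3)] assms(4)]]
  by (simp add: power2_norm_eq_inner sqrt_on_square inner_commute)

section \<open>Sandwiched contractions as form inequalities\<close>

text \<open>The squared norm of a square root is the form of the operator. Cauchy-Schwarz then gives
  one direction, and \<open>form_factorization\<close> through the two roots with constant 1 gives
  the other. The resulting criterion contains no square roots.\<close>

lemma sandwich_contraction_iff:
  assumes H1: "csubspace H1" "closed H1" and H2: "csubspace H2" "closed H2"
    and P: "positive_on H1 P" and Q: "positive_on H2 Q" and K: "K \<in> bops H2 H1"
  shows "sandwich_contraction H1 H2 P K Q \<longleftrightarrow>
    (\<forall>x\<in>H1. \<forall>y\<in>H2. (inner (K y) x)\<^sup>2 \<le> inner (P x) x * inner (Q y) y)"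
proof
  define P' Q' where defs: "P' = sqrt_on H1 P" "Q' = sqrt_on H2 Q"
  have P': "P' \<in> bops H1 H1" and Q': "Q' \<in> bops H2 H2"
    unfolding defs using H1 H2 P Q by (auto intro: sqrt_on_bops)
  have norms: "inner (P x) x * inner (Q y) y = (norm (P' x) * norm (Q' y))\<^sup>2"
    if "x \<in> H1" "y \<in> H2" for x y
    using norm_sqrt_on[OF H1 P that(1)] norm_sqrt_on[OF H2 Q that(2)]
    by (simp add: defs power_mult_distrib)
  have sym: "inner (P' u) x = inner u (P' x)" if "u \<in> H1" "x \<in> H1" for u x
    unfolding defs using H1 P that by (rule sqrt_on_sym)
  {
    assume "sandwich_contraction H1 H2 P K Q"
    then obtain K' where K': "K' \<in> contractions H2 H1" "\<And>y. y \<in> H2 \<Longrightarrow> K y = P' (K' (Q' y))"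
      by (auto simp: sandwich_contraction_def defs)
    have "(inner (K y) x)\<^sup>2 \<le> inner (P x) x * inner (Q y) y" if xy: "x \<in> H1" "y \<in> H2" for x y
    proof -
      have in_H: "Q' y \<in> H2" "K' (Q' y) \<in> H1"
        using K'(1) bops_in[OF Q' xy(2)] by (simp_all add: contractions_def bops_in[of K' H2 H1])
      have "\<bar>inner (K y) x\<bar> = \<bar>inner (K' (Q' y)) (P' x)\<bar>"
        using K'(2) xy in_H by (simp add: sym)
      also have "\<dots> \<le> norm (K' (Q' y)) * norm (P' x)"
        by (rule Cauchy_Schwarz_ineq2)
      also have "\<dots> \<le> norm (Q' y) * norm (P' x)"
        using K'(1) in_H by (intro mult_right_mono) (auto simp: contractions_def)
      finally have "\<bar>inner (K y) x\<bar>\<^sup>2 \<le> (norm (P' x) * norm (Q' y))\<^sup>2"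
        by (intro power_mono) (auto simp: mult.commute)
      then show ?thesis using norms[OF xy] by simp
    qed
    then show "\<forall>x\<in>H1. \<forall>y\<in>H2. (inner (K y) x)\<^sup>2 \<le> inner (P x) x * inner (Q y) y"
      by blast
  }
  assume le: "\<forall>x\<in>H1. \<forall>y\<in>H2. (inner (K y) x)\<^sup>2 \<le> inner (P x) x * inner (Q y) y"
  have bound: "\<bar>inner (K y) x\<bar> \<le> 1 * norm (P' x) * norm (Q' y)" if "x \<in> H1" "y \<in> H2" for x y
    by (rule power2_le_imp_le) (use le[rule_format, OF that] norms[OF that] in simp_all)
  obtain K' where K': "K' \<in> bops UNIV (closure (P' ` H1))" "\<forall>v. norm (K' v) \<le> 1 * norm v"
    "\<forall>x\<in>H1. \<forall>y\<in>H2. inner (K y) x = inner (K' (Q' y)) (P' x)"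
    using form_factorization[OF H1(1) H2(1) P' Q' K zero_le_one bound] by blast
  have "closure (P' ` H1) \<subseteq> H1"
    using H1(2) bops_in[OF P'] by (intro closure_minimal) auto
  then have K'_bops: "K' \<in> bops H2 H1"
    by (rule bops_mono[OF K'(1) subset_UNIV])
  have "K y = P' (K' (Q' y))" if y: "y \<in> H2" for y
  proof (rule closure_inner_eqI[OF H1(1)])
    have in_H: "K y \<in> H1" "K' (Q' y) \<in> H1" "P' (K' (Q' y)) \<in> H1"
      using y bops_in[OF K] bops_in[OF K'_bops] bops_in[OF Q'] bops_in[OF P'] by auto
    show "K y \<in> closure H1" "P' (K' (Q' y)) \<in> closure H1"
      using in_H(1,3) closure_subset[of H1] by blast+
    show "inner (K y) z = inner (P' (K' (Q' y))) z" if "z \<in> H1" for z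
      using K'(3)[rule_format, OF that y] sym[OF in_H(2) that] by simp
  qed
  then show "sandwich_contraction H1 H2 P K Q"
    unfolding sandwich_contraction_def contractions_def defs[symmetric]
    using K'_bops K'(2) by auto
qed

section \<open>Triangular contractions\<close>

lemma upper_block_bops:
  fixes A :: "'a::chilbert_space \<Rightarrow> 'a" and B :: "'b::chilbert_space \<Rightarrow> 'b"
  assumes "A \<in> bops UNIV UNIV" "C \<in> bops UNIV UNIV" "B \<in> bops UNIV UNIV"
  shows "upper_block A C B \<in> bops UNIV UNIV"
proof -
  obtain a where a: "a \<ge> 0" "\<And>x. norm (A x) \<le> a * norm x"
    using bops_bound[OF assms(1)] by (metis UNIV_I)
  obtain b where b: "b \<ge> 0" "\<And>y. norm (B y) \<le> b * norm y"
    using bops_bound[OF assms(3)] by (metis UNIV_I)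
  obtain c where c: "c \<ge> 0" "\<And>y. norm (C y) \<le> c * norm y"
    using bops_bound[OF assms(2)] by (metis UNIV_I)
  show ?thesis
  proof (rule bopsI)
    fix z w :: "'a \<times> 'b" and k
    show "upper_block A C B (z + w) = upper_block A C B z + upper_block A C B w"
      by (cases z; cases w) (simp add: upper_block_def bops_add[OF assms(1)] bops_add[OF assms(2)]
          bops_add[OF assms(3)])
    show "upper_block A C B (k *\<^sub>C z) = k *\<^sub>C upper_block A C B z"
      by (cases z) (simp add: upper_block_def scaleC_prod_def bops_scaleC[OF assms(1)]
          bops_scaleC[OF assms(2)] bops_scaleC[OF assms(3)] scaleC_add_right)
    obtain x y where z: "z = (x, y)" by (cases z)
    have "norm x \<le> norm z" "norm y \<le> norm z"
      unfolding z using norm_fst_le norm_snd_le by blast+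
    then have "a * norm x \<le> a * norm z" "b * norm y \<le> b * norm z" "c * norm y \<le> c * norm z"
      using a(1) b(1) c(1) by (auto intro: mult_left_mono)
    moreover have "norm (upper_block A C B z) \<le> norm (A x + C y) + norm (B y)"
      unfolding z upper_block_def by (simp add: norm_Pair_le)
    ultimately show "norm (upper_block A C B z) \<le> (a + c + b) * norm z"
      using a(2)[of x] b(2)[of y] c(2)[of y] norm_triangle_ineq[of "A x" "C y"] by (simp add: algebra_simps)
  qed auto
qed

text \<open>Necessity comes from suitable test vectors and a discriminant. For sufficiency, the
  squared norm of \<open>w = A x + C y\<close> is split into \<open>inner x (adj A w)\<close> and
  \<open>inner (C y) w\<close>, which are estimated together by Cauchy-Schwarz in the plane.\<close>

lemma upper_block_contraction_iff:
  fixes A :: "'a::chilbert_space \<Rightarrow> 'a" and B :: "'b::chilbert_space \<Rightarrow> 'b"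
  assumes A: "A \<in> bops UNIV UNIV" and C: "C \<in> bops UNIV UNIV" and B: "B \<in> bops UNIV UNIV"
    and A_le: "\<And>x. norm (A x) \<le> norm x" and B_le: "\<And>y. norm (B y) \<le> norm y"
  shows "(\<forall>z. norm (upper_block A C B z) \<le> norm z) \<longleftrightarrow>
    (\<forall>x y. (inner (C y) x)\<^sup>2 \<le>
      ((norm x)\<^sup>2 - (norm (adj A x))\<^sup>2) * ((norm y)\<^sup>2 - (norm (B y))\<^sup>2))"
proof -
  have norm_iff: "norm (upper_block A C B (x, y)) \<le> norm (x, y) \<longleftrightarrow>
      (norm (A x + C y))\<^sup>2 \<le> (norm x)\<^sup>2 + ((norm y)\<^sup>2 - (norm (B y))\<^sup>2)" for x y
    by (simp add: upper_block_def norm_Pair algebra_simps)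
  have A_gap: "(norm (adj A x))\<^sup>2 \<le> (norm x)\<^sup>2" for x
    using norm_adj_le[OF A A_le] by (simp add: power_mono)
  have B_gap: "(norm (B y))\<^sup>2 \<le> (norm y)\<^sup>2" for y
    using B_le by (simp add: power_mono)
  show ?thesis
  proof (intro iffI allI)
    fix x y assume contr: "\<forall>z. norm (upper_block A C B z) \<le> norm z"
    define X a b c where defs: "X = (norm x)\<^sup>2" "a = (norm (adj A x))\<^sup>2"
      "b = (norm y)\<^sup>2 - (norm (B y))\<^sup>2" "c = inner (C y) x"
    have nonneg: "0 \<le> a" "a \<le> X" "0 \<le> b"
      using A_gap B_gap by (auto simp: defs)
    txt \<open>Test the contraction on the vectors \<open>(t A\<^sup>* x, r y)\<close>.\<close>
    have form: "(t * a + r * c)\<^sup>2 \<le> X * (t\<^sup>2 * a + r\<^sup>2 * b)" for t r :: real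
    proof -
      let ?p = "t *\<^sub>R adj A x" and ?q = "r *\<^sub>R y"
      have "inner (A ?p + C ?q) x = t * a + r * c"
        by (simp add: defs inner_add_left bops_scaleR[OF A] bops_scaleR[OF C] inner_adj[OF A]
            power2_norm_eq_inner)
      then have "(t * a + r * c)\<^sup>2 \<le> (norm (A ?p + C ?q))\<^sup>2 * X"
        using Cauchy_Schwarz_ineq[of "A ?p + C ?q" x] by (simp add: defs power2_norm_eq_inner)
      also have "\<dots> \<le> (t\<^sup>2 * a + r\<^sup>2 * b) * X"
        using contr norm_iff[of ?p ?q]
        by (intro mult_right_mono) (auto simp: defs bops_scaleR[OF B] power_mult_distrib algebra_simps)
      finally show ?thesis by (simp add: mult.commute)
    qed
    have "c\<^sup>2 \<le> (X - a) * b"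
    \<comment> \<open>In either degenerate case \<open>a = 0\<close>, and \<open>t = 0\<close>,
      \<open>r = 1\<close> already gives the claim.\<close>
    proof (cases "X = 0 \<or> a = 0")
      case True
      then show ?thesis using form[of 0 1] nonneg by auto
    next
      case False
      then have "X > 0" "a > 0" using nonneg by auto
      \<comment> \<open>This is the discriminant of \<open>form\<close> with \<open>r = 1\<close>,
        read as a quadratic in \<open>t\<close>. After expansion the common positive factor
        \<open>a * X\<close> cancels.\<close>
      have "(- (a * c))\<^sup>2 \<le> (X * a - a\<^sup>2) * (X * b - c\<^sup>2)"
      proof (rule quad_nonneg)
        show "0 \<le> (X * a - a\<^sup>2) * t\<^sup>2 + 2 * - (a * c) * t + (X * b - c\<^sup>2)" for t
          using form[of t 1] by (simp add: power2_eq_square algebra_simps)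
        show "0 \<le> X * a - a\<^sup>2"
          using nonneg by (simp add: power2_eq_square mult_right_mono)
      qed
      then have "(a * X) * c\<^sup>2 \<le> (a * X) * ((X - a) * b)"
        by (simp add: power2_eq_square algebra_simps)
      then show ?thesis
        using \<open>X > 0\<close> \<open>a > 0\<close> by (simp add: mult_le_cancel_left_pos)
    qed
    then show "(inner (C y) x)\<^sup>2 \<le>
        ((norm x)\<^sup>2 - (norm (adj A x))\<^sup>2) * ((norm y)\<^sup>2 - (norm (B y))\<^sup>2)"
      by (simp add: defs)
  next
    fix z :: "'a \<times> 'b" assume form: "\<forall>x y. (inner (C y) x)\<^sup>2 \<le>
        ((norm x)\<^sup>2 - (norm (adj A x))\<^sup>2) * ((norm y)\<^sup>2 - (norm (B y))\<^sup>2)"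
    obtain x y where z: "z = (x, y)" by (cases z)
    define w b where defs: "w = A x + C y" "b = (norm y)\<^sup>2 - (norm (B y))\<^sup>2"
    define W a where defs': "W = (norm w)\<^sup>2" "a = (norm (adj A w))\<^sup>2"
    have "b \<ge> 0" "a \<ge> 0" "a \<le> W" "W \<ge> 0"
      using B_gap A_gap by (auto simp: defs defs')
    have "\<bar>inner (C y) w\<bar> \<le> sqrt (W - a) * sqrt b"
      using form unfolding real_sqrt_mult[symmetric]
      by (intro real_le_rsqrt) (auto simp: defs defs')
    moreover have "\<bar>inner x (adj A w)\<bar> \<le> norm x * sqrt a"
      using Cauchy_Schwarz_ineq2[of x "adj A w"] by (simp add: defs')
    moreover have "W = inner x (adj A w) + inner (C y) w"
      by (simp add: defs' power2_norm_eq_inner inner_adj[OF A, symmetric]) (simp add: defs inner_add_left)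
    \<comment> \<open>The two estimates are the coordinates of a planar inner product whose second
      vector has norm \<open>sqrt W\<close>.\<close>
    ultimately have "W \<le> inner (norm x, sqrt b) (sqrt a, sqrt (W - a))"
      by (simp add: mult.commute)
    also have "\<dots> \<le> sqrt ((norm x)\<^sup>2 + b) * sqrt W"
      using Cauchy_Schwarz_ineq2[of "(norm x, sqrt b)" "(sqrt a, sqrt (W - a))"]
        \<open>b \<ge> 0\<close> \<open>a \<ge> 0\<close> \<open>a \<le> W\<close> by (simp add: norm_Pair)
    finally have le: "sqrt W * sqrt W \<le> sqrt ((norm x)\<^sup>2 + b) * sqrt W"
      using \<open>W \<ge> 0\<close> by simp
    have "sqrt W \<le> sqrt ((norm x)\<^sup>2 + b)"
    proof (cases "W = 0")
      case False
      from le show ?thesis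
      by (rule mult_right_le_imp_le) (use \<open>W \<ge> 0\<close> False in simp)
    qed (use \<open>b \<ge> 0\<close> in simp)
    then have "W \<le> (norm x)\<^sup>2 + b"
      by (simp only: real_sqrt_le_iff)
    then show "norm (upper_block A C B z) \<le> norm z"
      using norm_iff by (simp add: z defs defs')
  qed
qed

section \<open>Defect and angle operators\<close>

context
  fixes X :: "'a::chilbert_space \<Rightarrow> 'a"
  assumes X: "X \<in> bops UNIV UNIV" and X_le: "\<And>x. norm (X x) \<le> norm x"
begin

lemma positive_on_defect: "positive_on UNIV (\<lambda>x. x - adj X (X x))"
  unfolding positive_on_iff[OF csubspace_UNIV]
proof (intro conjI ballI)
  show "(\<lambda>x. x - adj X (X x)) \<in> bops UNIV UNIV"
    by (intro bops_minus bops_id bops_comp[OF X adj_bops[OF X]]) auto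
  show "inner (x - adj X (X x)) y = inner x (y - adj X (X y))" for x y
    by (simp add: inner_simps inner_adj'[OF X] inner_adj[OF X, symmetric])
  show "0 \<le> inner (x - adj X (X x)) x" for x
    using power_mono[OF X_le[of x], of 2]
    by (simp add: inner_simps inner_adj'[OF X] power2_norm_eq_inner)
qed

lemma defect_bops: "defect X \<in> bops UNIV UNIV"
  unfolding defect_def by (intro sqrt_on_bops positive_on_defect) auto

lemma defect_sym: "inner (defect X x) y = inner x (defect X y)"
  unfolding defect_def by (intro sqrt_on_sym positive_on_defect) auto

lemma norm_defect: "(norm (defect X x))\<^sup>2 = (norm x)\<^sup>2 - (norm (X x))\<^sup>2"
  unfolding defect_def
  by (subst norm_sqrt_on[OF _ _ positive_on_defect])
    (auto simp: inner_simps inner_adj'[OF X] power2_norm_eq_inner)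

end

text \<open>Expresses the form of the imaginary part without the adjoint, in a shape visibly
  symmetric in \<open>x\<close> and \<open>y\<close>.\<close>

lemma inner_op_Im:
  assumes "T \<in> bops UNIV UNIV"
  shows "inner (op_Im T x) y = (inner (T x) (\<i> *\<^sub>C y) + inner (T y) (\<i> *\<^sub>C x)) / 2"
proof -
  have "1 / (2 * \<i>) = complex_of_real (- 1 / 2) * \<i>"
    by (simp add: field_simps)
  then have "op_Im T x = - (1/2) *\<^sub>R \<i> *\<^sub>C (T x - adj T x)"
    unfolding op_Im_def by (simp only: scaleC_scaleC[symmetric] scaleC_of_real) simp
  then have "inner (op_Im T x) y = - (1/2) * inner (\<i> *\<^sub>C (T x - adj T x)) y"
    by (simp only: inner_scaleR_left)
  also have "inner (\<i> *\<^sub>C (T x - adj T x)) y = - inner (T x) (\<i> *\<^sub>C y) + inner x (\<i> *\<^sub>C T y)"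
    by (simp add: inner_ii_left[of "T x - adj T x"] inner_diff_left inner_adj'[OF assms]
        bops_scaleC[OF assms])
  also have "inner x (\<i> *\<^sub>C T y) = - inner (T y) (\<i> *\<^sub>C x)"
    using inner_ii_left[of x "T y"] by (simp add: inner_commute)
  finally show ?thesis by (simp add: field_simps)
qed

lemma op_Im_bops: "T \<in> bops UNIV UNIV \<Longrightarrow> op_Im T \<in> bops UNIV UNIV"
  unfolding op_Im_def by (intro bops_scaleC_left bops_minus adj_bops) auto

text \<open>Since \<open>2 cot \<phi>\<close> times the imaginary part is symmetric and dominated by
  the form of the square of \<open>D\<close>, \<open>form_factorization\<close> through
  \<open>D\<close> on both sides yields a contraction \<open>W\<close>. Its symmetry is clear on the
  range of \<open>D\<close>, passes to the closure by continuity, and extends to the whole space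
  because \<open>W\<close> vanishes on the orthogonal complement.\<close>

lemma normalized_angle_op_exists:
  assumes T: "T \<in> bops UNIV UNIV" and D: "D \<in> bops UNIV UNIV"
    and D_sym: "\<And>x y. inner (D x) y = inner x (D y)"
    and bound: "\<And>x. \<bar>2 * cot \<phi> * inner (op_Im T x) x\<bar> \<le> (norm (D x))\<^sup>2"
  shows "\<exists>W. normalized_angle_op \<phi> T D W"
proof -
  define G where "G = (\<lambda>x. (2 * cot \<phi>) *\<^sub>R op_Im T x)"
  have G: "G \<in> bops UNIV UNIV"
    unfolding G_def using T by (intro bops_scaleR_left op_Im_bops) auto
  have G_sym: "inner (G x) y = inner x (G y)" for x y
    by (simp add: G_def inner_op_Im[OF T] inner_commute[of x])
  have form: "\<bar>inner (G y) x\<bar> \<le> 1 * norm (D x) * norm (D y)" for x y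
    using symmetric_form_bound[OF csubspace_UNIV G D G_sym, of y x] bound
    by (simp add: G_def mult.commute)
  obtain W where W: "W \<in> bops UNIV (closure (range D))" "\<forall>v. norm (W v) \<le> 1 * norm v"
    and W_eq: "\<forall>x\<in>UNIV. \<forall>y\<in>UNIV. inner (G y) x = inner (W (D y)) (D x)"
    and W_ker: "\<forall>v. (\<forall>y\<in>UNIV. inner v (D y) = 0) \<longrightarrow> W v = 0"
    using form_factorization[OF csubspace_UNIV csubspace_UNIV D D G zero_le_one form] by blast
  have W': "W \<in> bops UNIV UNIV" using W(1) by (rule bops_mono) auto
  note blW = bops_bounded_linear[OF W']
  note contW = bounded_linear.continuous_on[OF blW]
  have sym_range: "inner (W u) v = inner u (W v)" if u: "u \<in> range D" and v: "v \<in> range D" for u v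
    using W_eq G_sym u v by (metis UNIV_I image_iff inner_commute)
  have sym_left: "inner (W u) v = inner u (W v)" if u: "u \<in> closure (range D)" and v: "v \<in> range D" for u v
  proof -
    have "closed {u. inner (W u) v = inner u (W v)}"
      by (intro closed_Collect_eq continuous_intros contW)
    then show ?thesis
      using closure_minimal[of "range D" "{u. inner (W u) v = inner u (W v)}"] u v sym_range by blast
  qed
  have sym_closure: "inner (W u) v = inner u (W v)"
    if u: "u \<in> closure (range D)" and v: "v \<in> closure (range D)" for u v
  proof -
    have "closed {v. inner (W u) v = inner u (W v)}"
      by (intro closed_Collect_eq continuous_intros contW)
    then show ?thesis
      using closure_minimal[of "range D" "{v. inner (W u) v = inner u (W v)}"] u v sym_left by blast
  qed
  \<comment> \<open>\<open>p\<close> is the orthogonal projection of \<open>v\<close> onto the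
    closed range of \<open>D\<close>, obtained by representing \<open>inner v (D y)\<close> through
    \<open>D\<close>.\<close>
  have proj: "\<exists>p\<in>closure (range D). W v = W p \<and> (\<forall>w\<in>closure (range D). inner v w = inner p w)" for v
  proof -
    obtain p where p: "p \<in> closure (range D)" "\<And>y. inner v (D y) = inner p (D y)"
      by (rule riesz_pullback[OF csubspace_UNIV D, of "\<lambda>y. inner v (D y)" "norm v"])
        (auto simp: bops_add[OF D] bops_scaleR[OF D] inner_simps Cauchy_Schwarz_ineq2)
    have "W (v - p) = 0"
      using p(2) by (intro W_ker[rule_format]) (simp add: inner_diff_left)
    then have "W v = W p" by (simp add: bops_diff[OF W'])
    moreover have "inner v w = inner p w" if "w \<in> closure (range D)" for w
      using that by (rule inner_closure_eq) (use p(2) in auto)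
    ultimately show ?thesis using p(1) by blast
  qed
  have "inner (W u) v = inner u (W v)" for u v
  proof -
    obtain p where p: "p \<in> closure (range D)" "W u = W p" "\<forall>w\<in>closure (range D). inner u w = inner p w"
      using proj by blast
    obtain q where q: "q \<in> closure (range D)" "W v = W q" "\<forall>w\<in>closure (range D). inner v w = inner q w"
      using proj by blast
    have "inner (W u) v = inner (W p) q"
      using p q bops_in[OF W(1)] by (metis UNIV_I inner_commute)
    also have "\<dots> = inner p (W q)" using p q by (intro sym_closure)
    also have "\<dots> = inner u (W v)" using p q bops_in[OF W(1)] by (metis UNIV_I)
    finally show ?thesis .
  qed
  then have "selfadjoint W" using W' by (intro selfadjointI)
  moreover have "G = D \<circ> W \<circ> D"
  proof
    fix y
    have "inner x (G y) = inner x ((D \<circ> W \<circ> D) y)" for x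
      using W_eq[rule_format, of x y] D_sym[of x] by (simp add: inner_commute)
    then show "G y = (D \<circ> W \<circ> D) y" by (metis vector_eq_ldot)
  qed
  \<comment> \<open>As \<open>D\<close> is symmetric, its kernel is orthogonal to its range.\<close>
  moreover have "W x = 0" if "D x = 0" for x
    using that by (intro W_ker[rule_format]) (simp add: D_sym[symmetric])
  ultimately have "normalized_angle_op \<phi> T D W"
    using W' W(2) by (simp add: normalized_angle_op_def contractions_def G_def)
  then show ?thesis by blast
qed

section \<open>Properties of an arbitrary normalized angle operator\<close>

context
  fixes \<phi> :: real and T D W :: "'a::chilbert_space \<Rightarrow> 'a"
  assumes D: "D \<in> bops UNIV UNIV" and D_sym: "\<And>x y. inner (D x) y = inner x (D y)"
    and W: "normalized_angle_op \<phi> T D W"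
begin

lemma angle_op_bops: "W \<in> bops UNIV UNIV"
  using W by (simp add: normalized_angle_op_def selfadjoint_def)

lemma inner_angle_op: "inner (W (D x)) (D x) = 2 * cot \<phi> * inner (op_Im T x) x"
proof -
  have "(2 * cot \<phi>) *\<^sub>R op_Im T x = D (W (D x))"
    using W by (metis (no_types, lifting) normalized_angle_op_def comp_apply)
  from arg_cong[OF this, of "\<lambda>v. inner v x"] show ?thesis
    by (simp add: D_sym)
qed

lemma inner_angle_op_le: "\<bar>inner (W x) x\<bar> \<le> (norm x)\<^sup>2"
proof -
  have "norm (W x) \<le> norm x"
    using W by (simp add: normalized_angle_op_def contractions_def)
  then show ?thesis
    using Cauchy_Schwarz_ineq2[of "W x" x] mult_right_mono[of "norm (W x)" "norm x" "norm x"]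
    by (simp add: power2_eq_square)
qed

text \<open>The component of \<open>W x\<close> orthogonal to the range of \<open>D\<close> lies in
  the kernel of \<open>D\<close>, so \<open>W\<close> kills it by normalization; selfadjointness
  then makes it orthogonal to \<open>W x\<close>, hence zero. Thus \<open>W\<close> acts inside the
  defect space.\<close>

lemma angle_op_in_closure: "W x \<in> closure (range D)"
proof -
  obtain p where p: "p \<in> closure (range D)" "\<And>y. inner (W x) (D y) = inner p (D y)"
    by (rule riesz_pullback[OF csubspace_UNIV D, of "\<lambda>y. inner (W x) (D y)" "norm (W x)"])
      (auto simp: bops_add[OF D] bops_scaleR[OF D] inner_simps Cauchy_Schwarz_ineq2)
  let ?d = "W x - p"
  have orth: "inner ?d (D y) = 0" for y
    using p(2) by (simp add: inner_diff_left)
  then have "D ?d = 0"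
    by (metis D_sym inner_eq_zero_iff)
  then have "W ?d = 0"
    using W by (simp add: normalized_angle_op_def)
  then have "inner (W x) ?d = 0"
    using W selfadjoint_inner by (metis inner_zero_right normalized_angle_op_def)
  moreover have "inner ?d p = 0"
    using inner_closure_eq[OF p(1), of ?d 0] orth by auto
  ultimately have "inner ?d ?d = 0"
    by (simp add: inner_diff_left inner_diff_right inner_commute)
  then show ?thesis using p(1) by simp
qed

text \<open>The form of a selfadjoint contraction is at most the squared norm. With
  \<open>e = 1\<close> and \<open>e = -1\<close> this justifies the square roots in
  \<open>sandwich_contraction\<close>.\<close>

lemma positive_on_angle_op:
  assumes "\<bar>e\<bar> \<le> 1"
  shows "positive_on (closure (range D)) (\<lambda>x. x + e *\<^sub>R W x)"
proof -
  let ?H = "closure (range D)"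
  have H: "csubspace ?H"
    by (intro csubspace_closure csubspace_image[OF _ D]) auto
  have WH: "W \<in> bops ?H ?H"
    using bops_mono[OF angle_op_bops, of ?H UNIV] angle_op_in_closure by (auto simp: bops_def)
  show ?thesis
    unfolding positive_on_iff[OF H]
  proof (intro conjI ballI)
    show "(\<lambda>x. x + e *\<^sub>R W x) \<in> bops ?H ?H"
      by (intro bops_plus bops_id bops_scaleR_left WH H order_refl)
    show "inner (x + e *\<^sub>R W x) y = inner x (y + e *\<^sub>R W y)" for x y
      using W selfadjoint_inner[of W x y] by (simp add: inner_simps normalized_angle_op_def)
    show "0 \<le> inner (x + e *\<^sub>R W x) x" for x
    proof -
      have "\<bar>e * inner (W x) x\<bar> \<le> 1 * (norm x)\<^sup>2"
        unfolding abs_mult using assms inner_angle_op_le by (intro mult_mono) auto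
      then show ?thesis by (simp add: inner_simps power2_norm_eq_inner)
    qed
  qed
qed

end

section \<open>The class \<open>C(\<phi>)\<close>\<close>

text \<open>With \<open>s = sin \<phi>\<close> and \<open>k = cos \<phi>\<close> or
  \<open>k = - cos \<phi>\<close> these are the two operators that define the class. Real parameters
  let both signs be treated at once.\<close>

definition shift :: "real \<Rightarrow> real \<Rightarrow> ('a::chilbert_space \<Rightarrow> 'a) \<Rightarrow> 'a \<Rightarrow> 'a"
  where "shift s k T = (\<lambda>x. s *\<^sub>R T x + k *\<^sub>R \<i> *\<^sub>C x)"

lemma shift_bops: "T \<in> bops UNIV UNIV \<Longrightarrow> shift s k T \<in> bops UNIV UNIV"
  unfolding shift_def by (intro bops_plus bops_scaleR_left bops_scaleC_left bops_id) auto

lemma adj_shift: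
  assumes T: "T \<in> bops UNIV UNIV"
  shows "adj (shift s k T) = shift s (- k) (adj T)"
  by (rule adj_eqI[OF shift_bops[OF T]])
    (simp add: shift_def inner_simps inner_adj[OF T] inner_ii_left)

lemma inner_op_Im_self: "T \<in> bops UNIV UNIV \<Longrightarrow> inner (op_Im T x) x = inner (T x) (\<i> *\<^sub>C x)"
  by (simp add: inner_op_Im)

lemma norm_shift:
  assumes T: "T \<in> bops UNIV UNIV"
  shows "(norm (shift s k T x))\<^sup>2 = s\<^sup>2 * (norm (T x))\<^sup>2 + k\<^sup>2 * (norm x)\<^sup>2 + 2 * s * k * inner (op_Im T x) x"
  unfolding inner_op_Im_self[OF T]
  by (simp add: shift_def power2_norm_eq_inner inner_simps inner_commute)
    (simp add: power2_eq_square algebra_simps)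

text \<open>Passing to the adjoint reverses both the sign of \<open>k\<close> and that of the
  imaginary part, so the mixed term stays the same as in \<open>norm_shift\<close>.\<close>

lemma norm_shift_adj:
  assumes T: "T \<in> bops UNIV UNIV"
  shows "(norm (adj (shift s k T) x))\<^sup>2 =
    s\<^sup>2 * (norm (adj T x))\<^sup>2 + k\<^sup>2 * (norm x)\<^sup>2 + 2 * s * k * inner (op_Im T x) x"
proof -
  have "inner (op_Im (adj T) x) x = inner (adj T x) (\<i> *\<^sub>C x)"
    by (rule inner_op_Im_self[OF adj_bops[OF T]])
  also have "\<dots> = inner x (\<i> *\<^sub>C T x)"
    by (simp add: inner_adj'[OF T] bops_scaleC[OF T])
  also have "\<dots> = - inner (op_Im T x) x"
    unfolding inner_op_Im_self[OF T] using inner_ii_left[of x "T x"] by (simp add: inner_commute)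
  finally show ?thesis
    unfolding adj_shift[OF T] norm_shift[OF adj_bops[OF T]] by simp
qed

lemma C_class_iff:
  "T \<in> C_class \<phi> \<longleftrightarrow> T \<in> bops UNIV UNIV \<and>
    (\<forall>e\<in>{1, -1}. \<forall>x. norm (shift (sin \<phi>) (e * cos \<phi>) T x) \<le> norm x)"
proof -
  have *: "onorm F \<le> 1 \<longleftrightarrow> (\<forall>x. norm (F x) \<le> norm x)" if "F \<in> bops UNIV UNIV"
    for F :: "'a \<Rightarrow> 'a"
  proof
    assume "onorm F \<le> 1"
    then have "onorm F * norm x \<le> 1 * norm x" for x
      by (rule mult_right_mono) simp
    then show "\<forall>x. norm (F x) \<le> norm x"
      using onorm[OF bops_bounded_linear[OF that]] by (metis mult_1 order_trans)
  next
    assume "\<forall>x. norm (F x) \<le> norm x"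
    then show "onorm F \<le> 1" by (intro onorm_bound) auto
  qed
  have "(\<i> * complex_of_real (cos \<phi>)) *\<^sub>C x = cos \<phi> *\<^sub>R \<i> *\<^sub>C x" for x :: 'a
    by (metis mult.commute scaleC_scaleC scaleC_of_real)
  then have eqs: "shift (sin \<phi>) (1 * cos \<phi>) T = (\<lambda>x. sin \<phi> *\<^sub>R T x + (\<i> * cos \<phi>) *\<^sub>C x)"
    "shift (sin \<phi>) (-1 * cos \<phi>) T = (\<lambda>x. sin \<phi> *\<^sub>R T x - (\<i> * cos \<phi>) *\<^sub>C x)"
    by (simp_all add: shift_def)
  then show ?thesis
    using *[OF shift_bops[of T]] by (auto simp: C_class_def simp flip: eqs)
qed

lemma shift_upper_block:
  "shift s k (upper_block T11 T12 T22) = upper_block (shift s k T11) (\<lambda>y. s *\<^sub>R T12 y) (shift s k T22)"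
  by (auto simp: fun_eq_iff shift_def upper_block_def scaleC_prod_def scaleR_add_right)

section \<open>Gap identities and defect operators for members of the class\<close>

context
  fixes \<phi> :: real and T :: "'a::chilbert_space \<Rightarrow> 'a"
  assumes \<phi>: "\<phi> \<in> {0<..<pi/2}" and T: "T \<in> C_class \<phi>"
begin

lemma C_class_bops: "T \<in> bops UNIV UNIV"
  using T by (simp add: C_class_iff)

lemma shift_le: "e \<in> {1, -1} \<Longrightarrow> norm (shift (sin \<phi>) (e * cos \<phi>) T x) \<le> norm x"
  using T by (auto simp: C_class_iff)

lemma sin_pos: "sin \<phi> > 0"
  using \<phi> by (auto intro: sin_gt_zero)

text \<open>Replacing the squared cosine by 1 minus the squared sine lets
  \<open>(sin \<phi>)\<^sup>2\<close> be factored out; the mixed coefficient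
  \<open>sin \<phi> * cos \<phi>\<close> then leaves \<open>cot \<phi>\<close>.\<close>

lemma shift_gap:
  assumes e: "e \<in> {1, -1}"
  shows "(norm x)\<^sup>2 - (norm (shift (sin \<phi>) (e * cos \<phi>) T x))\<^sup>2 =
      (sin \<phi>)\<^sup>2 * ((norm x)\<^sup>2 - (norm (T x))\<^sup>2 - e * (2 * cot \<phi> * inner (op_Im T x) x))"
    and "(norm x)\<^sup>2 - (norm (adj (shift (sin \<phi>) (e * cos \<phi>) T) x))\<^sup>2 =
      (sin \<phi>)\<^sup>2 * ((norm x)\<^sup>2 - (norm (adj T x))\<^sup>2 - e * (2 * cot \<phi> * inner (op_Im T x) x))"
proof -
  have "e\<^sup>2 = 1" using e by auto
  moreover have "(cos \<phi>)\<^sup>2 = 1 - (sin \<phi>)\<^sup>2"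
    by (rule cos_squared_eq)
  moreover have "(sin \<phi>)\<^sup>2 * cot \<phi> = sin \<phi> * cos \<phi>"
    using sin_pos by (simp add: cot_def power2_eq_square)
  ultimately have "r - (s + (e * cos \<phi>)\<^sup>2 * r + 2 * sin \<phi> * (e * cos \<phi>) * i) =
      (sin \<phi>)\<^sup>2 * (r - t - e * (2 * cot \<phi> * i))" if "s = (sin \<phi>)\<^sup>2 * t" for r s t i :: real
    using that by algebra
  from this[OF refl] show "(norm x)\<^sup>2 - (norm (shift (sin \<phi>) (e * cos \<phi>) T x))\<^sup>2 =
      (sin \<phi>)\<^sup>2 * ((norm x)\<^sup>2 - (norm (T x))\<^sup>2 - e * (2 * cot \<phi> * inner (op_Im T x) x))"
    and "(norm x)\<^sup>2 - (norm (adj (shift (sin \<phi>) (e * cos \<phi>) T) x))\<^sup>2 =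
      (sin \<phi>)\<^sup>2 * ((norm x)\<^sup>2 - (norm (adj T x))\<^sup>2 - e * (2 * cot \<phi> * inner (op_Im T x) x))"
    unfolding norm_shift[OF C_class_bops] norm_shift_adj[OF C_class_bops] by blast+
qed

text \<open>The two signs of \<open>e\<close> give the two sides of the absolute value. These are
  the form bounds from which the angle operators are built.\<close>

lemma C_class_gap:
  shows "\<bar>2 * cot \<phi> * inner (op_Im T x) x\<bar> \<le> (norm x)\<^sup>2 - (norm (T x))\<^sup>2"
    and "\<bar>2 * cot \<phi> * inner (op_Im T x) x\<bar> \<le> (norm x)\<^sup>2 - (norm (adj T x))\<^sup>2"
proof -
  have "0 \<le> (sin \<phi>)\<^sup>2 * ((norm x)\<^sup>2 - (norm (T x))\<^sup>2 - e * (2 * cot \<phi> * inner (op_Im T x) x))"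
    "0 \<le> (sin \<phi>)\<^sup>2 * ((norm x)\<^sup>2 - (norm (adj T x))\<^sup>2 - e * (2 * cot \<phi> * inner (op_Im T x) x))"
    if "e \<in> {1, -1}" for e
    using power_mono[OF shift_le[OF that, of x], of 2]
      power_mono[OF norm_adj_le[OF shift_bops[OF C_class_bops] shift_le[OF that], of x], of 2]
    unfolding shift_gap[OF that, symmetric] by auto
  then have "0 \<le> (norm x)\<^sup>2 - (norm (T x))\<^sup>2 - e * (2 * cot \<phi> * inner (op_Im T x) x)"
    "0 \<le> (norm x)\<^sup>2 - (norm (adj T x))\<^sup>2 - e * (2 * cot \<phi> * inner (op_Im T x) x)"
    if "e \<in> {1, -1}" for e
    using that sin_pos by (auto simp: zero_le_mult_iff)
  from this[of 1] this[of "-1"]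
  show "\<bar>2 * cot \<phi> * inner (op_Im T x) x\<bar> \<le> (norm x)\<^sup>2 - (norm (T x))\<^sup>2"
    and "\<bar>2 * cot \<phi> * inner (op_Im T x) x\<bar> \<le> (norm x)\<^sup>2 - (norm (adj T x))\<^sup>2"
    by (auto simp: abs_le_iff)
qed

text \<open>The gaps dominate an absolute value, so they are nonnegative. This makes the facts about
  defect operators available for members of the class and their adjoints.\<close>

lemma C_class_contraction: "norm (T x) \<le> norm x" "norm (adj T x) \<le> norm x"
proof -
  have "(norm (T x))\<^sup>2 \<le> (norm x)\<^sup>2" "(norm (adj T x))\<^sup>2 \<le> (norm x)\<^sup>2"
    using C_class_gap[of x] abs_ge_zero[of "2 * cot \<phi> * inner (op_Im T x) x"] by linarith+
  from this[THEN power2_le_imp_le[OF _ norm_ge_zero]]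
  show "norm (T x) \<le> norm x" "norm (adj T x) \<le> norm x" .
qed

lemmas C_class_defect_bops = defect_bops[OF C_class_bops C_class_contraction(1)]
  and C_class_defect_sym = defect_sym[OF C_class_bops C_class_contraction(1)]
  and C_class_norm_defect = norm_defect[OF C_class_bops C_class_contraction(1)]
  and C_class_defect_adj_bops = defect_bops[OF adj_bops[OF C_class_bops] C_class_contraction(2)]
  and C_class_defect_adj_sym = defect_sym[OF adj_bops[OF C_class_bops] C_class_contraction(2)]
  and C_class_norm_defect_adj = norm_defect[OF adj_bops[OF C_class_bops] C_class_contraction(2)]

lemma C_class_angle_op_exists: "\<exists>W. normalized_angle_op \<phi> T (defect T) W"
  by (rule normalized_angle_op_exists[OF C_class_bops C_class_defect_bops C_class_defect_sym])
    (unfold C_class_norm_defect, rule C_class_gap(1))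

lemma C_class_angle_op_adj_exists: "\<exists>W. normalized_angle_op \<phi> T (defect (adj T)) W"
  by (rule normalized_angle_op_exists[OF C_class_bops C_class_defect_adj_bops C_class_defect_adj_sym])
    (unfold C_class_norm_defect_adj, rule C_class_gap(2))

text \<open>Presents the gap as a form evaluated at the defect vector, ready for the factor
  belonging to \<open>B\<close> in \<open>upper_block_contraction_iff\<close>. The sign
  \<open>e\<close> of the shift turns into \<open>- e\<close> in front of \<open>W\<close>.\<close>

lemma shift_gap_defect:
  assumes "e \<in> {1, -1}" "normalized_angle_op \<phi> T (defect T) W"
  shows "(norm x)\<^sup>2 - (norm (shift (sin \<phi>) (e * cos \<phi>) T x))\<^sup>2 =
    (sin \<phi>)\<^sup>2 * inner (defect T x - e *\<^sub>R W (defect T x)) (defect T x)"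
  using shift_gap(1)[OF assms(1), of x] inner_angle_op[OF C_class_defect_bops C_class_defect_sym assms(2), of x]
  by (simp add: C_class_norm_defect inner_diff_left flip: power2_norm_eq_inner)

lemma shift_adj_gap_defect:
  assumes "e \<in> {1, -1}" "normalized_angle_op \<phi> T (defect (adj T)) W"
  shows "(norm x)\<^sup>2 - (norm (adj (shift (sin \<phi>) (e * cos \<phi>) T) x))\<^sup>2 =
    (sin \<phi>)\<^sup>2 * inner (defect (adj T) x - e *\<^sub>R W (defect (adj T) x)) (defect (adj T) x)"
  using shift_gap(2)[OF assms(1), of x]
    inner_angle_op[OF C_class_defect_adj_bops C_class_defect_adj_sym assms(2), of x]
  by (simp add: C_class_norm_defect_adj inner_diff_left flip: power2_norm_eq_inner)

end

section \<open>Triangular operators in the class\<close>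

text \<open>Both shifts of the block operator are triangular, so the contraction criterion applies
  to each. The gaps contribute \<open>(sin \<phi>)\<^sup>2\<close> twice, and one of these factors
  cancels against the scaled corner entry.\<close>

lemma upper_block_C_class_iff:
  assumes \<phi>: "\<phi> \<in> {0<..<pi/2}" and T11: "T11 \<in> C_class \<phi>" and T22: "T22 \<in> C_class \<phi>"
    and U: "normalized_angle_op \<phi> T11 (defect (adj T11)) U"
    and V: "normalized_angle_op \<phi> T22 (defect T22) V"
    and T12: "T12 \<in> bops UNIV UNIV"
  shows "upper_block T11 T12 T22 \<in> C_class \<phi> \<longleftrightarrow>
    (\<forall>e\<in>{1, -1}. \<forall>x y. (inner (T12 y) x)\<^sup>2 \<le> (sin \<phi>)\<^sup>2 *
      (inner (defect (adj T11) x + e *\<^sub>R U (defect (adj T11) x)) (defect (adj T11) x) *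
       inner (defect T22 y + e *\<^sub>R V (defect T22 y)) (defect T22 y)))"
    (is "_ \<longleftrightarrow> (\<forall>e\<in>_. \<forall>x y. _ \<le> _ * (?p e x * ?q e y))")
proof -
  note T11' = C_class_bops[OF \<phi> T11] and T22' = C_class_bops[OF \<phi> T22]
  have s: "sin \<phi> > 0" by (rule sin_pos[OF \<phi> T11])
  have sign: "(\<forall>z. norm (shift (sin \<phi>) (e * cos \<phi>) (upper_block T11 T12 T22) z) \<le> norm z) \<longleftrightarrow>
      (\<forall>x y. (inner (T12 y) x)\<^sup>2 \<le> (sin \<phi>)\<^sup>2 * (?p (- e) x * ?q (- e) y))"
    if e: "e \<in> {1, -1}" for e
  proof -
    have "(inner (sin \<phi> *\<^sub>R T12 y) x)\<^sup>2 \<le> ((sin \<phi>)\<^sup>2 * ?p (- e) x) * ((sin \<phi>)\<^sup>2 * ?q (- e) y) \<longleftrightarrow>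
        (inner (T12 y) x)\<^sup>2 \<le> (sin \<phi>)\<^sup>2 * (?p (- e) x * ?q (- e) y)" for x y
    proof -
      have "(inner (sin \<phi> *\<^sub>R T12 y) x)\<^sup>2 = (sin \<phi>)\<^sup>2 * (inner (T12 y) x)\<^sup>2"
        by (simp add: power_mult_distrib)
      moreover have "((sin \<phi>)\<^sup>2 * ?p (- e) x) * ((sin \<phi>)\<^sup>2 * ?q (- e) y) =
          (sin \<phi>)\<^sup>2 * ((sin \<phi>)\<^sup>2 * (?p (- e) x * ?q (- e) y))"
        by (simp only: mult_ac)
      ultimately show ?thesis
        using s by (simp only: mult_le_cancel_left_pos[OF zero_less_power[OF s]])
    qed
    then show ?thesis
      unfolding shift_upper_block
      by (subst upper_block_contraction_iff[OF shift_bops[OF T11'] bops_scaleR_left[OF csubspace_UNIV T12]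
            shift_bops[OF T22'] shift_le[OF \<phi> T11 e] shift_le[OF \<phi> T22 e]])
        (simp add: shift_adj_gap_defect[OF \<phi> T11 e U] shift_gap_defect[OF \<phi> T22 e V])
  qed
  \<comment> \<open>The sign reversal in \<open>sign\<close> only exchanges the two
    conditions.\<close>
  show ?thesis
    unfolding C_class_iff using upper_block_bops[OF T11' T12 T22'] sign[of 1] sign[of "-1"] by auto
qed

theorem proposition5p5:
  fixes T11 :: "'a::chilbert_space \<Rightarrow> 'a"
    and T22 :: "'b::chilbert_space \<Rightarrow> 'b"
    and \<phi> :: real
  assumes "separable_space (euclidean :: 'a topology)"
    and "separable_space (euclidean :: 'b topology)"
    and "\<phi> \<in> {0<..<pi/2}"
    and "T11 \<in> C_class \<phi>"
    and "T22 \<in> C_class \<phi>"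
  defines "H1 \<equiv> defect_space (adj T11)"
    and "H2 \<equiv> defect_space T22"
  shows
    "(\<exists>U V. normalized_angle_op \<phi> T11 (defect (adj T11)) U \<and>
            normalized_angle_op \<phi> T22 (defect T22) V) \<and>
     (\<forall>U V. normalized_angle_op \<phi> T11 (defect (adj T11)) U \<and>
            normalized_angle_op \<phi> T22 (defect T22) V \<longrightarrow>
        (\<forall>T12\<in>bops UNIV UNIV.
           upper_block T11 T12 T22 \<in> C_class \<phi> \<longleftrightarrow>
           (\<exists>K\<in>bops H2 H1.
              T12 = (\<lambda>y. sin \<phi> *\<^sub>R defect (adj T11) (K (defect T22 y))) \<and>
              sandwich_contraction H1 H2 (\<lambda>x. x + U x) K (\<lambda>y. y + V y) \<and>
              sandwich_contraction H1 H2 (\<lambda>x. x - U x) K (\<lambda>y. y - V y))))"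
proof (intro conjI allI impI ballI)
  note \<phi> = assms(3) and T11 = assms(4) and T22 = assms(5)
  show "\<exists>U V. normalized_angle_op \<phi> T11 (defect (adj T11)) U \<and>
      normalized_angle_op \<phi> T22 (defect T22) V"
    using C_class_angle_op_adj_exists[OF \<phi> T11] C_class_angle_op_exists[OF \<phi> T22] by blast
  fix U V T12
  assume "normalized_angle_op \<phi> T11 (defect (adj T11)) U \<and> normalized_angle_op \<phi> T22 (defect T22) V"
  then have U: "normalized_angle_op \<phi> T11 (defect (adj T11)) U"
    and V: "normalized_angle_op \<phi> T22 (defect T22) V" by auto
  assume T12: "T12 \<in> bops (UNIV :: 'b set) (UNIV :: 'a set)"
  define D1 D2 where defs: "D1 = defect (adj T11)" "D2 = defect T22"
  note D1 = C_class_defect_adj_bops[OF \<phi> T11, folded defs]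
    and D1_sym = C_class_defect_adj_sym[OF \<phi> T11, folded defs]
    and D2 = C_class_defect_bops[OF \<phi> T22, folded defs]
    and D2_sym = C_class_defect_sym[OF \<phi> T22, folded defs]
  note U' = U[folded defs] and V' = V[folded defs]
  have H_defs: "H1 = closure (range D1)" "H2 = closure (range D2)"
    by (simp_all add: H1_def H2_def defect_space_def defs)
  have H: "csubspace H1" "closed H1" "csubspace H2" "closed H2"
    unfolding H_defs
    by (simp_all add: csubspace_closure csubspace_image[OF csubspace_UNIV D1]
        csubspace_image[OF csubspace_UNIV D2])
  have D_in: "D1 x \<in> H1" "D2 y \<in> H2" for x y
    unfolding H_defs by (rule subsetD[OF closure_subset], simp)+
  have s: "sin \<phi> > 0" by (rule sin_pos[OF \<phi> T11])
  \<comment> \<open>The sign parameter \<open>e\<close> joins the identity plus and minus the angle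
    operators in one argument.\<close>
  define P Q where PQ: "P = (\<lambda>e x. x + e *\<^sub>R U x)" "Q = (\<lambda>e y. y + e *\<^sub>R V y)"
  have P: "positive_on H1 (P e)" if "e \<in> {1, -1}" for e
    unfolding H_defs PQ by (rule positive_on_angle_op[OF D1 D1_sym U']) (use that in auto)
  have Q: "positive_on H2 (Q e)" if "e \<in> {1, -1}" for e
    unfolding H_defs PQ by (rule positive_on_angle_op[OF D2 D2_sym V']) (use that in auto)
  have P_le: "\<bar>inner (P e x) x\<bar> \<le> 2 * (norm x)\<^sup>2" if "e \<in> {1, -1}" for e x
    using inner_angle_op_le[OF D1 D1_sym U', of x] that
    by (auto simp: PQ inner_simps simp flip: power2_norm_eq_inner)
  have Q_le: "\<bar>inner (Q e y) y\<bar> \<le> 2 * (norm y)\<^sup>2" if "e \<in> {1, -1}" for e y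
    using inner_angle_op_le[OF D2 D2_sym V', of y] that
    by (auto simp: PQ inner_simps simp flip: power2_norm_eq_inner)
  have block_iff: "upper_block T11 T12 T22 \<in> C_class \<phi> \<longleftrightarrow>
      (\<forall>e\<in>{1, -1}. \<forall>x y. (inner (T12 y) x)\<^sup>2 \<le>
        (sin \<phi>)\<^sup>2 * (inner (P e (D1 x)) (D1 x) * inner (Q e (D2 y)) (D2 y)))"
    using upper_block_C_class_iff[OF \<phi> T11 T22 U V T12] unfolding PQ defs .
  have sandwich_iff: "sandwich_contraction H1 H2 (\<lambda>x. x + U x) K (\<lambda>y. y + V y) \<and>
      sandwich_contraction H1 H2 (\<lambda>x. x - U x) K (\<lambda>y. y - V y) \<longleftrightarrow>
      (\<forall>e\<in>{1, -1}. \<forall>x\<in>H1. \<forall>y\<in>H2. (inner (K y) x)\<^sup>2 \<le> inner (P e x) x * inner (Q e y) y)"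
    if K: "K \<in> bops H2 H1" for K
    using sandwich_contraction_iff[OF H P[of 1] Q[of 1] K] sandwich_contraction_iff[OF H P[of "-1"] Q[of "-1"] K]
    by (simp add: PQ)
  show "upper_block T11 T12 T22 \<in> C_class \<phi> \<longleftrightarrow>
      (\<exists>K\<in>bops H2 H1. T12 = (\<lambda>y. sin \<phi> *\<^sub>R defect (adj T11) (K (defect T22 y))) \<and>
        sandwich_contraction H1 H2 (\<lambda>x. x + U x) K (\<lambda>y. y + V y) \<and>
        sandwich_contraction H1 H2 (\<lambda>x. x - U x) K (\<lambda>y. y - V y))"
    unfolding defs[symmetric]
  proof
    assume "\<exists>K\<in>bops H2 H1. T12 = (\<lambda>y. sin \<phi> *\<^sub>R D1 (K (D2 y))) \<and>
        sandwich_contraction H1 H2 (\<lambda>x. x + U x) K (\<lambda>y. y + V y) \<and>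
        sandwich_contraction H1 H2 (\<lambda>x. x - U x) K (\<lambda>y. y - V y)"
    then obtain K where K: "K \<in> bops H2 H1" and T12_eq: "T12 = (\<lambda>y. sin \<phi> *\<^sub>R D1 (K (D2 y)))"
      and form: "\<forall>e\<in>{1, -1}. \<forall>x\<in>H1. \<forall>y\<in>H2. (inner (K y) x)\<^sup>2 \<le> inner (P e x) x * inner (Q e y) y"
      using sandwich_iff by blast
    show "upper_block T11 T12 T22 \<in> C_class \<phi>"
      unfolding block_iff
    proof (intro ballI allI)
      fix e x y assume e: "e \<in> {1, -1 :: real}"
      have "(inner (T12 y) x)\<^sup>2 = (sin \<phi>)\<^sup>2 * (inner (K (D2 y)) (D1 x))\<^sup>2"
        by (simp add: T12_eq D1_sym power_mult_distrib)
      also have "\<dots> \<le> (sin \<phi>)\<^sup>2 * (inner (P e (D1 x)) (D1 x) * inner (Q e (D2 y)) (D2 y))"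
        using form e D_in by (intro mult_left_mono) auto
      finally show "(inner (T12 y) x)\<^sup>2 \<le> \<dots>" .
    qed
  next
    assume "upper_block T11 T12 T22 \<in> C_class \<phi>"
    then have block: "(inner (T12 y) x)\<^sup>2 \<le>
        (sin \<phi>)\<^sup>2 * (inner (P e (D1 x)) (D1 x) * inner (Q e (D2 y)) (D2 y))"
      if "e \<in> {1, -1}" for e x y
      using that unfolding block_iff by blast
    \<comment> \<open>A crude bound from the condition for \<open>e = 1\<close>: the forms of
      \<open>P 1\<close> and \<open>Q 1\<close> are at most twice the squared norm. It serves to
      obtain a bounded \<open>K0\<close>; the sharp inequalities follow in
      \<open>form\<close>.\<close>
    have bound: "\<bar>inner (T12 y) x\<bar> \<le> (2 * sin \<phi>) * norm (D1 x) * norm (D2 y)" for x y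
    proof (rule power2_le_imp_le)
      have "\<bar>inner (P 1 (D1 x)) (D1 x) * inner (Q 1 (D2 y)) (D2 y)\<bar> \<le>
          (2 * (norm (D1 x))\<^sup>2) * (2 * (norm (D2 y))\<^sup>2)"
        unfolding abs_mult using P_le[of 1] Q_le[of 1] by (intro mult_mono) auto
      then have "(sin \<phi>)\<^sup>2 * (inner (P 1 (D1 x)) (D1 x) * inner (Q 1 (D2 y)) (D2 y)) \<le>
          (sin \<phi>)\<^sup>2 * ((2 * (norm (D1 x))\<^sup>2) * (2 * (norm (D2 y))\<^sup>2))"
        by (intro mult_left_mono) auto
      also have "\<dots> = ((2 * sin \<phi>) * norm (D1 x) * norm (D2 y))\<^sup>2"
        by (simp add: power_mult_distrib)
      finally show "\<bar>inner (T12 y) x\<bar>\<^sup>2 \<le> ((2 * sin \<phi>) * norm (D1 x) * norm (D2 y))\<^sup>2"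
        using block[of 1 y x] by simp
    qed (use s in simp)
    have "0 \<le> 2 * sin \<phi>" using s by simp
    then obtain K0 where K0: "K0 \<in> bops UNIV H1"
      and K0_eq: "\<And>x y. inner (T12 y) x = inner (K0 (D2 y)) (D1 x)"
      using form_factorization[OF csubspace_UNIV csubspace_UNIV D1 D2 T12 _ bound] unfolding H_defs by blast
    define K where "K = (\<lambda>v. (1 / sin \<phi>) *\<^sub>R K0 v)"
    have K_UNIV: "K \<in> bops UNIV H1"
      unfolding K_def using H(1) K0 by (rule bops_scaleR_left)
    then have K: "K \<in> bops H2 H1" by (rule bops_mono) auto
    have K_eq: "inner (T12 y) x = sin \<phi> * inner (K (D2 y)) (D1 x)" for x y
      using s by (simp add: K_def K0_eq)
    have T12_eq: "T12 = (\<lambda>y. sin \<phi> *\<^sub>R D1 (K (D2 y)))"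
    proof
      fix y
      have "inner (T12 y) x = inner (sin \<phi> *\<^sub>R D1 (K (D2 y))) x" for x
        by (simp add: K_eq D1_sym)
      then show "T12 y = sin \<phi> *\<^sub>R D1 (K (D2 y))" by (metis vector_eq_rdot)
    qed
    \<comment> \<open>For vectors in the ranges of \<open>D1\<close> and \<open>D2\<close> this is
      \<open>block\<close> divided by \<open>(sin \<phi>)\<^sup>2\<close>. Both sides are
      continuous, so it extends to the closures \<open>H1\<close> and \<open>H2\<close>, one
      variable at a time.\<close>
    have form: "(inner (K y) x)\<^sup>2 \<le> inner (P e x) x * inner (Q e y) y"
      if e: "e \<in> {1, -1}" and x: "x \<in> H1" and y: "y \<in> H2" for e x y
    proof -
      note continuous = bounded_linear.continuous_on[OF bops_bounded_linear continuous_on_id]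
      have cont: "continuous_on UNIV (\<lambda>u. P e u)" "continuous_on UNIV (\<lambda>v. Q e v)" "continuous_on UNIV (\<lambda>v. K v)"
        unfolding PQ
        by (intro continuous_intros continuous[OF angle_op_bops[OF D1 D1_sym U']]
            continuous[OF angle_op_bops[OF D2 D2_sym V']] continuous[OF K_UNIV])+
      have range: "(inner (K v) u)\<^sup>2 \<le> inner (P e u) u * inner (Q e v) v"
        if uv: "u \<in> range D1" "v \<in> range D2" for u v
      proof -
        obtain x y where xy: "u = D1 x" "v = D2 y" using uv by blast
        have "(sin \<phi>)\<^sup>2 * (inner (K v) u)\<^sup>2 \<le> (sin \<phi>)\<^sup>2 * (inner (P e u) u * inner (Q e v) v)"
          using block[OF e, of y x] by (simp add: K_eq xy power_mult_distrib)
        then show ?thesis using s by (simp add: mult_le_cancel_left_pos)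
      qed
      have left: "(inner (K v) x)\<^sup>2 \<le> inner (P e x) x * inner (Q e v) v" if v: "v \<in> range D2" for v
      proof -
        have "closed {u. (inner (K v) u)\<^sup>2 \<le> inner (P e u) u * inner (Q e v) v}"
          by (intro closed_Collect_le continuous_intros cont)
        then show ?thesis
          using closure_minimal[of "range D1" "{u. (inner (K v) u)\<^sup>2 \<le> inner (P e u) u * inner (Q e v) v}"]
            x range v unfolding H_defs by blast
      qed
      have "closed {v. (inner (K v) x)\<^sup>2 \<le> inner (P e x) x * inner (Q e v) v}"
        by (intro closed_Collect_le continuous_intros cont)
      then show ?thesis
        using closure_minimal[of "range D2" "{v. (inner (K v) x)\<^sup>2 \<le> inner (P e x) x * inner (Q e v) v}"]
          y left unfolding H_defs by blast
    qed
    then have "\<forall>e\<in>{1, -1}. \<forall>x\<in>H1. \<forall>y\<in>H2. (inner (K y) x)\<^sup>2 \<le> inner (P e x) x * inner (Q e y) y"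
      by (intro ballI)
    then have "T12 = (\<lambda>y. sin \<phi> *\<^sub>R D1 (K (D2 y))) \<and>
        sandwich_contraction H1 H2 (\<lambda>x. x + U x) K (\<lambda>y. y + V y) \<and>
        sandwich_contraction H1 H2 (\<lambda>x. x - U x) K (\<lambda>y. y - V y)"
      by (intro conjI[OF T12_eq] iffD2[OF sandwich_iff[OF K]])
    then show "\<exists>K\<in>bops H2 H1. T12 = (\<lambda>y. sin \<phi> *\<^sub>R D1 (K (D2 y))) \<and>
        sandwich_contraction H1 H2 (\<lambda>x. x + U x) K (\<lambda>y. y + V y) \<and>
        sandwich_contraction H1 H2 (\<lambda>x. x - U x) K (\<lambda>y. y - V y)"
      using K by (rule bexI)
  qed
qed

end
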